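(* For every universal semi-POVM $M$ there exists a sequence $F_0,F_1,F_2,\dots$ of semi-POVMs on $\Sigma^*$ such that: (i) $F_n(s)\in\mathrm{Her}_Q(N)$ and $0<F_n(s)\leqslant F_{n+1}(s)\leqslant M(s)$ for all $(n,s)\in\mathbb{N}\times\Sigma^*$ (where $0<A$ means $A$ is positive definite); (ii) $F_n\to M$ uniformly, i.e. $\sup_{s\in\Sigma^*}\|F_n(s)-M(s)\|\to 0$ as $n\to\infty$; (iii) the map $\mathbb{N}\times\Sigma^*\ni(n,s)\mapsto F_n(s)$ is a total recursive function.
   Context: $N$ is a fixed positive integer; $\Sigma^*$ is the set of finite binary strings. $\mathrm{Her}(N)$ is the set of $N\times N$ Hermitian matrices and $\mathrm{Her}_Q(N)$ those with entries in $\{a+ib:a,b\in\mathbb{Q}\}$; $A\leqslant B$ means $B-A$ is positive semi-definite; $\|\cdot\|$ is the operator norm. A semi-POVM on $\Sigma^*$ is a map $R:\Sigma^*\to\mathrm{Her}(N)$ with $0\leqslant R(s)$ for all $s$ and $\sum_s R(s)\leqslant I$. A lower-computable semi-POVM is a semi-POVM $R$ for which there is a total recursive $f:\mathbb{N}\times\Sigma^*\to\mathrm{Her}_Q(N)$ with $\lim_{n}f(n,s)=R(s)$ and $f(n,s)\leqslant R(s)$ for all $n,s$. A universal semi-POVM is a lower-computable semi-POVM $M$ such that for every lower-computable semi-POVM $R$ there is $c>0$ with $c\,R(s)\leqslant M(s)$ for all $s\in\Sigma^*$. *)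

theory Defs
  imports "HOL-Analysis.Analysis" "HOL-Library.Nat_Bijection"
begin

type_synonym 'n cmat = "complex^'n^'n"

definition hermitian :: "'n::finite cmat \<Rightarrow> bool" where
  "hermitian A \<longleftrightarrow> (\<forall>i j. A $ i $ j = cnj (A $ j $ i))"

definition qform :: "'n::finite cmat \<Rightarrow> complex^'n \<Rightarrow> complex" where
  "qform A x = (\<Sum>i\<in>UNIV. cnj (x $ i) * (A *v x) $ i)"

definition psd :: "'n::finite cmat \<Rightarrow> bool" where
  "psd A \<longleftrightarrow> hermitian A \<and> (\<forall>x. Im (qform A x) = 0 \<and> 0 \<le> Re (qform A x))"

definition posdef :: "'n::finite cmat \<Rightarrow> bool" where
  "posdef A \<longleftrightarrow> hermitian A \<and> (\<forall>x. x \<noteq> 0 \<longrightarrow> Im (qform A x) = 0 \<and> 0 < Re (qform A x))"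

definition loewner_le :: "'n::finite cmat \<Rightarrow> 'n cmat \<Rightarrow> bool" where
  "loewner_le A B \<longleftrightarrow> psd (B - A)"

definition opnorm :: "'n::finite cmat \<Rightarrow> real" where
  "opnorm A = onorm (\<lambda>x. A *v x)"

definition HerQ :: "'n::finite cmat set" where
  "HerQ = {A. hermitian A \<and> (\<forall>i j. Re (A $ i $ j) \<in> \<rat> \<and> Im (A $ i $ j) \<in> \<rat>)}"

definition semi_povm :: "(bool list \<Rightarrow> 'n::finite cmat) \<Rightarrow> bool" where
  "semi_povm R \<longleftrightarrow> (\<forall>s. loewner_le 0 (R s)) \<and>
     R summable_on UNIV \<and> loewner_le (infsum R UNIV) (mat 1)"

datatype recf = Zf | Sf | Idf nat | Cnf recf "recf list" | Prf recf recf | Mnf recf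

inductive eval_recf :: "recf \<Rightarrow> nat list \<Rightarrow> nat \<Rightarrow> bool" where
  zero: "eval_recf Zf xs 0"
| succ: "eval_recf Sf (x # xs) (Suc x)"
| proj: "i < length xs \<Longrightarrow> eval_recf (Idf i) xs (xs ! i)"
| comp: "list_all2 (\<lambda>h y. eval_recf h xs y) hs ys \<Longrightarrow> eval_recf g ys z \<Longrightarrow> eval_recf (Cnf g hs) xs z"
| pr0:  "eval_recf f xs z \<Longrightarrow> eval_recf (Prf f g) (0 # xs) z"
| prS:  "eval_recf (Prf f g) (n # xs) y \<Longrightarrow> eval_recf g (n # y # xs) z \<Longrightarrow>
         eval_recf (Prf f g) (Suc n # xs) z"
| mn:   "eval_recf f (n # xs) 0 \<Longrightarrow> (\<forall>m<n. \<exists>y. eval_recf f (m # xs) y \<and> 0 < y) \<Longrightarrow>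
         eval_recf (Mnf f) xs n"
monos list.rel_mono_strong

text \<open>bijective encoding of binary strings as natural numbers\<close>
fun bl_enc :: "bool list \<Rightarrow> nat" where
  "bl_enc [] = 0"
| "bl_enc (b # bs) = Suc (of_bool b + 2 * bl_enc bs)"

definition rat_dec :: "nat \<Rightarrow> real" where
  "rat_dec k = (case prod_decode k of (a, b) \<Rightarrow> real_of_int (int_decode a) / real b)"

definition gq_dec :: "nat \<Rightarrow> complex" where
  "gq_dec k = (case prod_decode k of (a, b) \<Rightarrow> Complex (rat_dec a) (rat_dec b))"

definition idx :: "'n::enum \<Rightarrow> nat" where
  "idx i = (THE k. k < length (enum_class.enum :: 'n list) \<and> enum_class.enum ! k = i)"

definition mat_dec :: "nat \<Rightarrow> 'n::enum cmat" where
  "mat_dec k = (\<chi> i j. gq_dec (nth_default 0 (list_decode k) (idx i * CARD('n) + idx j)))"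

definition total_recursive_mat :: "(nat \<Rightarrow> bool list \<Rightarrow> 'n::enum cmat) \<Rightarrow> bool" where
  "total_recursive_mat F \<longleftrightarrow> (\<exists>p. \<forall>n s. \<exists>y.
      eval_recf p [prod_encode (n, bl_enc s)] y \<and> mat_dec y = F n s)"

definition lower_computable :: "(bool list \<Rightarrow> 'n::enum cmat) \<Rightarrow> bool" where
  "lower_computable R \<longleftrightarrow> semi_povm R \<and>
     (\<exists>f. total_recursive_mat f \<and> (\<forall>n s. f n s \<in> HerQ) \<and>
          (\<forall>s. (\<lambda>n. f n s) \<longlonglongrightarrow> R s) \<and> (\<forall>n s. loewner_le (f n s) (R s)))"

definition universal_semi_povm :: "(bool list \<Rightarrow> 'n::enum cmat) \<Rightarrow> bool" where
  "universal_semi_povm M \<longleftrightarrow> lower_computable M \<and>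
     (\<forall>R. lower_computable R \<longrightarrow> (\<exists>c>0. \<forall>s. loewner_le (c *\<^sub>R R s) (M s)))"

end

theory Submission
  imports Defs
begin

text \<open>
Let \<open>f\<close> be a recursive approximation of \<open>M\<close> from below. The matrices
\<open>X k s = f k s - I / (k + 1)\<close> still converge to \<open>M s\<close> and lie strictly below it, while comparison with
the semi-POVM \<open>2\<^sup>-\<^sup>l I\<close>, \<open>l = bl_enc s + 1\<close>, shows that \<open>M s\<close> is positive definite. Hence, starting
from \<open>Z 0 s = 0\<close>, one can always search for some \<open>k \<ge> n\<close> with \<open>X k s - Z n s\<close> positive definite and
put \<open>Z (n + 1) s = X k s\<close>. The required sequence is \<open>F n = Z (n + 1)\<close>; convergence is uniform because
\<open>0 \<le> M s - F n s \<le> M s\<close> and the traces of the \<open>M s\<close> are summable.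

Positive definiteness of a Hermitian rational matrix \<open>D\<close> is made semi-decidable by a certificate: for
some \<open>t\<close> and \<open>j\<close> the Frobenius norm of \<open>B\<close> raised to the power \<open>2\<^sup>j\<close>, where \<open>B = I - D / (t + 1)\<close>, is
less than 1. For soundness, \<open>|B x|\<^sup>2 = \<langle>x, B\<^sup>2 x\<rangle> \<le> |x| |B\<^sup>2 x|\<close> brings the contraction property down
from \<open>B\<^sup>2\<close> to \<open>B\<close>. For completeness, \<open>|x - D x / T|\<^sup>2 \<le> (1 - 2 \<delta> / T + \<parallel>D\<parallel>\<^sup>2 / T\<^sup>2) |x|\<^sup>2\<close> when
\<open>\<delta> I \<le> D\<close>.
\<close>

section \<open>Hermitian matrices and certificates of positive definiteness\<close>

text \<open>\<open>norm\<close> on \<open>cmat\<close> is the Frobenius norm, the Euclidean norm of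
  the vector of row norms; the bound is Cauchy-Schwarz in every row.\<close>

lemma norm_matrix_vector_mult_le:
  fixes A :: "'n::finite cmat"
  shows "norm (A *v x) \<le> norm A * norm x"
proof -
  have *: "norm ((A *v x) $ i) \<le> norm (A $ i) * norm x" for i
  proof -
    have "norm ((A *v x) $ i) \<le> (\<Sum>j\<in>UNIV. norm (A $ i $ j) * norm (x $ j))"
      unfolding matrix_vector_mult_def by (simp add: norm_mult[symmetric] sum_norm_le)
    also have "\<dots> \<le> norm (A $ i) * norm x"
      unfolding norm_vec_def[of x] norm_vec_def[of "A $ i"]
      using L2_set_mult_ineq[of "\<lambda>j. norm (A $ i $ j)" "\<lambda>j. norm (x $ j)" UNIV] by simp
    finally show ?thesis .
  qed
  have "norm (A *v x) \<le> L2_set (\<lambda>i. norm (A $ i) * norm x) UNIV"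
    unfolding norm_vec_def[of "A *v x"] by (rule L2_set_mono) (use * in auto)
  also have "\<dots> = norm A * norm x"
    unfolding norm_vec_def[of A] by (simp add: L2_set_left_distrib)
  finally show ?thesis .
qed

text \<open>\<open>\<bullet>\<close> on complex vectors is the real part of the sesquilinear form,
  so positivity can be studied in a real inner product space.\<close>

lemma Re_qform: "Re (qform A x) = x \<bullet> (A *v x)"
  by (simp add: qform_def inner_vec_def inner_complex_def)

lemma inner_complex_vec: "x \<bullet> y = Re (\<Sum>i\<in>UNIV. cnj (x $ i) * y $ i)"
  for x y :: "complex^'n::finite"
  by (simp add: inner_vec_def inner_complex_def)

text \<open>Stated for the full complex form: \<open>\<bullet>\<close> keeps only its real part,
  from which \<open>hermitian_Im_qform\<close> could not be read off.\<close>

lemma hermitian_sesquilinear_swap: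
  assumes "hermitian A"
  shows "(\<Sum>i\<in>UNIV. cnj (x $ i) * (A *v y) $ i) = (\<Sum>i\<in>UNIV. cnj ((A *v x) $ i) * y $ i)"
proof -
  have "(\<Sum>i\<in>UNIV. cnj (x $ i) * (A *v y) $ i)
      = (\<Sum>i\<in>UNIV. \<Sum>j\<in>UNIV. cnj (x $ i) * (A $ i $ j * y $ j))"
    by (simp add: matrix_vector_mult_def sum_distrib_left)
  also have "\<dots> = (\<Sum>j\<in>UNIV. \<Sum>i\<in>UNIV. cnj (x $ i) * (A $ i $ j * y $ j))"
    by (rule sum.swap)
  also have "\<dots> = (\<Sum>j\<in>UNIV. \<Sum>i\<in>UNIV. cnj (A $ j $ i * x $ i) * y $ j)"
  proof (intro sum.cong refl)
    fix i j
    have "A $ i $ j = cnj (A $ j $ i)"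
      using assms unfolding hermitian_def by blast
    then show "cnj (x $ i) * (A $ i $ j * y $ j) = cnj (A $ j $ i * x $ i) * y $ j"
      by (simp only: complex_cnj_mult mult_ac)
  qed
  also have "\<dots> = (\<Sum>i\<in>UNIV. cnj ((A *v x) $ i) * y $ i)"
    by (simp add: matrix_vector_mult_def sum_distrib_right)
  finally show ?thesis .
qed

lemma hermitian_inner_swap:
  assumes "hermitian A"
  shows "x \<bullet> (A *v y) = (A *v x) \<bullet> y"
  unfolding inner_complex_vec hermitian_sesquilinear_swap[OF assms] ..

lemma hermitian_Im_qform:
  assumes "hermitian A"
  shows "Im (qform A x) = 0"
proof -
  have "qform A x = cnj (qform A x)"
    unfolding qform_def
    by (subst hermitian_sesquilinear_swap[OF assms]) (simp add: mult.commute)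
  then show ?thesis
    by (simp add: complex_eq_iff)
qed

lemma psd_iff: "psd A \<longleftrightarrow> hermitian A \<and> (\<forall>x. 0 \<le> x \<bullet> (A *v x))"
  using hermitian_Im_qform by (auto simp: psd_def Re_qform)

lemma posdef_iff: "posdef A \<longleftrightarrow> hermitian A \<and> (\<forall>x. x \<noteq> 0 \<longrightarrow> 0 < x \<bullet> (A *v x))"
  using hermitian_Im_qform by (auto simp: posdef_def Re_qform)

lemma posdef_imp_psd: "posdef A \<Longrightarrow> psd A"
  unfolding psd_iff posdef_iff by (metis inner_zero_left order_le_less)

lemma hermitianD: "hermitian A \<Longrightarrow> cnj (A $ j $ i) = A $ i $ j"
  by (metis hermitian_def)

lemma hermitian_add: "hermitian A \<Longrightarrow> hermitian B \<Longrightarrow> hermitian (A + B)"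
  unfolding hermitian_def[of "A + B"] by (simp add: hermitianD)

lemma hermitian_diff: "hermitian A \<Longrightarrow> hermitian B \<Longrightarrow> hermitian (A - B)"
  unfolding hermitian_def[of "A - B"] by (simp add: hermitianD)

lemma hermitian_scaleR: "hermitian A \<Longrightarrow> hermitian (c *\<^sub>R A)"
  unfolding hermitian_def[of "c *\<^sub>R A"] by (simp add: hermitianD)

lemma hermitian_mat: "hermitian (mat 1)"
  unfolding hermitian_def by (simp add: mat_def)

lemma hermitian_0: "hermitian 0"
  unfolding hermitian_def by simp

lemma hermitian_square: "hermitian A \<Longrightarrow> hermitian (A ** A)"
  unfolding hermitian_def[of "A ** A"]
  by (simp add: matrix_matrix_mult_def hermitianD mult.commute)

lemma scaleR_matrix_vector_mult: "(c *\<^sub>R A) *v x = c *\<^sub>R (A *v (x :: complex^'n))"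
  by (simp add: vec_eq_iff matrix_vector_mult_def scaleR_sum_right)

lemmas mat_vec_simps = matrix_vector_mult_add_rdistrib matrix_vector_mult_diff_rdistrib
  scaleR_matrix_vector_mult matrix_vector_mul_lid inner_add_right inner_diff_right inner_scaleR_right

lemma posdef_add_psd: "posdef A \<Longrightarrow> psd B \<Longrightarrow> posdef (A + B)"
  by (auto simp: posdef_iff psd_iff hermitian_add mat_vec_simps add_pos_nonneg)

lemma psd_add: "psd A \<Longrightarrow> psd B \<Longrightarrow> psd (A + B)"
  by (auto simp: psd_iff hermitian_add mat_vec_simps)

lemma posdef_scaleR: "posdef A \<Longrightarrow> 0 < c \<Longrightarrow> posdef (c *\<^sub>R A)"
  by (auto simp: posdef_iff hermitian_scaleR mat_vec_simps)

lemma posdef_mat: "posdef (mat 1)"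
  by (auto simp: posdef_iff hermitian_mat mat_vec_simps)

lemma loewner_le_inner: "loewner_le A B \<Longrightarrow> x \<bullet> (A *v x) \<le> x \<bullet> (B *v x)"
  by (simp add: loewner_le_def psd_iff mat_vec_simps)

text \<open>The quadratic form attains a minimum on the compact unit sphere, positive by assumption;
  homogeneity extends the bound to all vectors.\<close>

lemma posdef_lower_bound:
  assumes "posdef (A :: 'n::finite cmat)"
  obtains \<delta> where "0 < \<delta>" "\<And>x. \<delta> * (norm x)\<^sup>2 \<le> x \<bullet> (A *v x)"
proof -
  have cont: "continuous_on (sphere (0 :: complex^'n) 1) (\<lambda>x. x \<bullet> (A *v x))"
    unfolding matrix_vector_mult_def by (intro continuous_intros)
  have "axis undefined 1 \<in> sphere (0 :: complex^'n) 1"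
    by simp
  then obtain y where y: "y \<in> sphere 0 1"
    and min: "\<And>x. x \<in> sphere 0 1 \<Longrightarrow> y \<bullet> (A *v y) \<le> x \<bullet> (A *v x)"
    using continuous_attains_inf[OF compact_sphere _ cont] by blast
  define \<delta> where "\<delta> = y \<bullet> (A *v y)"
  have "\<delta> * (norm x)\<^sup>2 \<le> x \<bullet> (A *v x)" for x
  proof (cases "x = 0")
    case False
    have "\<delta> \<le> (x /\<^sub>R norm x) \<bullet> (A *v (x /\<^sub>R norm x))"
      unfolding \<delta>_def using False by (intro min) simp
    also have "A *v (x /\<^sub>R norm x) = (A *v x) /\<^sub>R norm x"
      by (simp add: vec_eq_iff matrix_vector_mult_def scaleR_sum_right)
    finally show ?thesis
      using False by (simp add: field_simps power2_eq_square)
  qed simp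
  moreover have "0 < \<delta>"
  proof -
    have "y \<noteq> 0"
      using y by auto
    then show ?thesis
      using assms unfolding posdef_iff \<delta>_def by blast
  qed
  ultimately show thesis
    using that by blast
qed

section \<open>Certificates by repeated squaring\<close>

definition msquare :: "'n::finite cmat \<Rightarrow> 'n cmat" where
  "msquare B = B ** B"

text \<open>The induction removes the innermost squaring, replacing \<open>B\<close> by its square,
  which is again hermitian. This is why \<open>B\<close> is generalised.\<close>

lemma hermitian_contraction_if_norm_msquare_less_1:
  assumes "hermitian B" "norm ((msquare ^^ j) B) < 1" "x \<noteq> 0"
  shows "norm (B *v x) < norm x"
  using assms
proof (induction j arbitrary: B)
  case 0
  have "norm (B *v x) \<le> norm B * norm x"
    by (rule norm_matrix_vector_mult_le)
  also have "\<dots> < norm x"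
    using 0 by simp
  finally show ?case .
next
  case (Suc j)
  have "norm ((msquare ^^ j) (msquare B)) < 1"
    using Suc.prems(2) by (simp add: funpow_swap1)
  then have IH: "norm (msquare B *v x) < norm x"
    using Suc.IH[of "msquare B"] Suc.prems(1,3) hermitian_square[of B]
    unfolding msquare_def[of B] by blast
  have "(norm (B *v x))\<^sup>2 = x \<bullet> (B *v (B *v x))"
    using hermitian_inner_swap[OF Suc.prems(1), of x "B *v x"] by (simp add: power2_norm_eq_inner)
  also have "\<dots> = x \<bullet> (msquare B *v x)"
    by (simp add: msquare_def matrix_vector_mul_assoc)
  also have "\<dots> \<le> norm x * norm (msquare B *v x)"
    by (rule norm_cauchy_schwarz)
  also have "\<dots> < norm x * norm x"
    using IH Suc.prems(3) by (intro mult_strict_left_mono) auto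
  finally show ?case
    using power2_less_imp_less[of "norm (B *v x)" "norm x"] by (simp add: power2_eq_square)
qed

text \<open>The Frobenius norm, unlike the operator norm, turns the test into a comparison of
  rationals. Powers are taken because the Frobenius norm of a strict contraction can exceed
  1.\<close>

definition pd_cert :: "'n::finite cmat \<Rightarrow> nat \<Rightarrow> nat \<Rightarrow> bool" where
  "pd_cert D t j \<longleftrightarrow> norm ((msquare ^^ j) (mat 1 - (1 / real (Suc t)) *\<^sub>R D)) < 1"

lemma posdef_if_pd_cert:
  assumes "hermitian D" "pd_cert D t j"
  shows "posdef D"
  unfolding posdef_iff
proof (intro conjI allI impI)
  fix x :: "complex^'a" assume x: "x \<noteq> 0"
  define B where "B = mat 1 - (1 / real (Suc t)) *\<^sub>R D"
  have "hermitian B"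
    unfolding B_def by (intro hermitian_diff hermitian_mat hermitian_scaleR assms)
  then have "norm (B *v x) < norm x"
    using assms(2) x hermitian_contraction_if_norm_msquare_less_1
    unfolding pd_cert_def B_def by blast
  then have "norm x * norm (B *v x) < norm x * norm x"
    using x by simp
  then have "x \<bullet> (B *v x) < x \<bullet> x"
    using norm_cauchy_schwarz[of x "B *v x"] by (simp add: dot_square_norm power2_eq_square)
  moreover have "x \<bullet> (B *v x) = x \<bullet> x - (x \<bullet> (D *v x)) / real (Suc t)"
    by (simp add: B_def mat_vec_simps)
  ultimately have "0 < (x \<bullet> (D *v x)) / real (Suc t)"
    by linarith
  then show "0 < x \<bullet> (D *v x)"
    by (simp add: zero_less_divide_iff)
qed (fact assms)

lemma norm_mat_le_sum: "norm (A :: 'n::finite cmat) \<le> (\<Sum>i\<in>UNIV. \<Sum>j\<in>UNIV. norm (A $ i $ j))"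
proof -
  have "norm A \<le> (\<Sum>i\<in>UNIV. norm (A $ i))"
    unfolding norm_vec_def[of A] by (rule L2_set_le_sum) simp
  also have "\<dots> \<le> (\<Sum>i\<in>UNIV. \<Sum>j\<in>UNIV. norm (A $ i $ j))"
  proof (rule sum_mono)
    show "norm (A $ i) \<le> (\<Sum>j\<in>UNIV. norm (A $ i $ j))" for i
      unfolding norm_vec_def[of "A $ i"] by (rule L2_set_le_sum) simp
  qed
  finally show ?thesis .
qed

text \<open>Each entry of \<open>A\<close> is a coordinate of the image of a unit vector, hence at
  most \<open>q\<close> in modulus. The crude dimension factor is harmless, as high powers of a
  number below 1 absorb it.\<close>

lemma norm_mat_le_columns:
  fixes A :: "'n::finite cmat"
  assumes "\<And>x. norm (A *v x) \<le> q * norm x"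
  shows "norm A \<le> (real CARD('n))\<^sup>2 * q"
proof -
  have entry: "norm (A $ i $ j) \<le> q" for i j
  proof -
    have "(A *v axis j 1) $ i = A $ i $ j"
      by (simp add: matrix_vector_mult_def axis_def if_distrib cong: if_cong)
    then have "norm (A $ i $ j) \<le> norm (A *v axis j 1)"
      by (metis Finite_Cartesian_Product.norm_nth_le)
    also have "\<dots> \<le> q"
      using assms[of "axis j 1"] by simp
    finally show ?thesis .
  qed
  have "norm A \<le> (\<Sum>i\<in>UNIV. \<Sum>j\<in>UNIV. norm (A $ i $ j))"
    by (rule norm_mat_le_sum)
  also have "\<dots> \<le> (\<Sum>i\<in>(UNIV :: 'n set). \<Sum>j\<in>(UNIV :: 'n set). q)"
    by (intro sum_mono entry)
  finally show ?thesis
    by (simp add: power2_eq_square)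
qed

text \<open>Squaring the matrix squares its contraction factor.\<close>

lemma norm_msquare_funpow_le:
  fixes B :: "'n::finite cmat"
  assumes "\<And>x. norm (B *v x) \<le> q * norm x" "0 \<le> q"
  shows "norm ((msquare ^^ j) B *v x) \<le> q ^ (2 ^ j) * norm x"
  using assms
proof (induction j arbitrary: B q x)
  case (Suc j)
  have "norm (msquare B *v x) \<le> q\<^sup>2 * norm x" for x
  proof -
    have "norm (msquare B *v x) \<le> q * norm (B *v x)"
      unfolding msquare_def matrix_vector_mul_assoc[symmetric] by (rule Suc.prems)
    also have "\<dots> \<le> q * (q * norm x)"
      by (intro mult_left_mono Suc.prems)
    finally show ?thesis
      by (simp add: power2_eq_square mult.assoc)
  qed
  then have "norm ((msquare ^^ j) (msquare B) *v x) \<le> (q\<^sup>2) ^ (2 ^ j) * norm x"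
    by (rule Suc.IH) simp
  then show ?case
    by (simp add: funpow_swap1 power_mult[symmetric])
qed simp

lemma pd_cert_if_posdef:
  fixes D :: "'n::finite cmat"
  assumes "posdef D"
  shows "\<exists>t j. pd_cert D t j"
proof -
  obtain \<delta> where \<delta>: "0 < \<delta>" "\<And>x. \<delta> * (norm x)\<^sup>2 \<le> x \<bullet> (D *v x)"
    using posdef_lower_bound[OF assms] by blast
  \<comment> \<open>This size of \<open>t\<close> makes the quadratic error term at most half of the
    linear gain \<open>2 * \<delta> / T\<close>.\<close>
  obtain t :: nat where t: "(norm D)\<^sup>2 / \<delta> < real t"
    using reals_Archimedean2 by blast
  define T where "T = real (Suc t)"
  have T: "0 < T" "(norm D)\<^sup>2 \<le> \<delta> * T"
    using t \<delta>(1) by (auto simp: T_def field_simps)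
  define B where "B = mat 1 - (1 / T) *\<^sub>R D"
  \<comment> \<open>The \<open>max\<close> saves a separate comparison of \<open>\<delta>\<close>
    with \<open>T\<close>.\<close>
  define q where "q = sqrt (max 0 (1 - \<delta> / T))"
  have q: "0 \<le> q" "q < 1"
    using \<delta>(1) T(1) by (auto simp: q_def real_less_lsqrt)
  have B: "norm (B *v x) \<le> q * norm x" for x
  proof -
    have "B *v x = x - (1 / T) *\<^sub>R (D *v x)"
      by (simp add: B_def mat_vec_simps)
    then have "(norm (B *v x))\<^sup>2 = (norm x)\<^sup>2 - 2 * (x \<bullet> (D *v x)) / T + (norm (D *v x))\<^sup>2 / T\<^sup>2"
      unfolding power2_norm_eq_inner
      by (simp add: inner_diff_left inner_diff_right inner_commute[of "D *v x" x] power2_eq_square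
          diff_divide_distrib)
    also have "\<dots> \<le> (norm x)\<^sup>2 - 2 * (\<delta> * (norm x)\<^sup>2) / T + \<delta> * (norm x)\<^sup>2 / T"
    proof -
      have "(norm (D *v x))\<^sup>2 \<le> (norm D * norm x)\<^sup>2"
        by (intro power_mono norm_matrix_vector_mult_le) simp
      also have "\<dots> \<le> \<delta> * T * (norm x)\<^sup>2"
        unfolding power_mult_distrib by (intro mult_right_mono T) simp
      finally have "(norm (D *v x))\<^sup>2 / T\<^sup>2 \<le> \<delta> * T * (norm x)\<^sup>2 / T\<^sup>2"
        by (intro divide_right_mono) auto
      also have "\<dots> = \<delta> * (norm x)\<^sup>2 / T"
        using T(1) by (simp add: power2_eq_square)
      finally have "(norm (D *v x))\<^sup>2 / T\<^sup>2 \<le> \<delta> * (norm x)\<^sup>2 / T" .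
      moreover have "2 * (\<delta> * (norm x)\<^sup>2) / T \<le> 2 * (x \<bullet> (D *v x)) / T"
        using \<delta>(2)[of x] T(1) by (intro divide_right_mono) auto
      ultimately show ?thesis by linarith
    qed
    also have "\<dots> = (1 - \<delta> / T) * (norm x)\<^sup>2"
      by (simp add: algebra_simps)
    also have "\<dots> \<le> q\<^sup>2 * (norm x)\<^sup>2"
      by (intro mult_right_mono) (auto simp: q_def)
    finally have "(norm (B *v x))\<^sup>2 \<le> (q * norm x)\<^sup>2"
      by (simp add: power_mult_distrib)
    then show ?thesis
      by (rule power2_le_imp_le) (simp add: q)
  qed
  \<comment> \<open>Plain powers suffice for the limit: \<open>j < 2 ^ j\<close> gives
    \<open>q ^ (2 ^ j) \<le> q ^ j\<close>.\<close>
  have "(\<lambda>j. (real CARD('n))\<^sup>2 * q ^ j) \<longlonglongrightarrow> (real CARD('n))\<^sup>2 * 0"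
    using q by (intro tendsto_intros LIMSEQ_power_zero) auto
  then have "eventually (\<lambda>j. (real CARD('n))\<^sup>2 * q ^ j < 1) sequentially"
    by (rule order_tendstoD) simp
  then obtain j where j: "(real CARD('n))\<^sup>2 * q ^ j < 1"
    by (metis eventually_happens' sequentially_bot)
  have "norm ((msquare ^^ j) B) \<le> (real CARD('n))\<^sup>2 * q ^ (2 ^ j)"
    by (intro norm_mat_le_columns norm_msquare_funpow_le B q)
  also have "\<dots> \<le> (real CARD('n))\<^sup>2 * q ^ j"
    using q by (intro mult_left_mono power_decreasing less_imp_le[OF less_exp]) auto
  finally show ?thesis
    using j unfolding pd_cert_def B_def T_def by (meson order_le_less_trans)
qed

text \<open>Positive definiteness is an open condition among hermitian matrices: a perturbation of
  norm below \<open>\<delta>\<close> changes the quadratic form by less than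
  \<open>\<delta> * (norm x)\<^sup>2\<close> at nonzero \<open>x\<close>.\<close>

lemma posdef_eventually:
  fixes X :: "nat \<Rightarrow> 'n::finite cmat"
  assumes "X \<longlonglongrightarrow> A" "posdef A" "\<And>k. hermitian (X k)"
  shows "eventually (\<lambda>k. posdef (X k)) sequentially"
proof -
  obtain \<delta> where \<delta>: "0 < \<delta>" "\<And>x. \<delta> * (norm x)\<^sup>2 \<le> x \<bullet> (A *v x)"
    using posdef_lower_bound[OF assms(2)] by blast
  have "eventually (\<lambda>k. dist (X k) A < \<delta>) sequentially"
    using assms(1) \<delta>(1) by (rule tendstoD)
  then show ?thesis
  proof eventually_elim
    case (elim k)
    have "0 < x \<bullet> (X k *v x)" if x: "x \<noteq> 0" for x
    proof -
      have "x \<bullet> ((A - X k) *v x) \<le> norm x * norm ((A - X k) *v x)"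
        by (rule norm_cauchy_schwarz)
      also have "\<dots> \<le> norm x * (norm (A - X k) * norm x)"
        by (intro mult_left_mono norm_matrix_vector_mult_le) simp
      also have "\<dots> = norm (A - X k) * (norm x)\<^sup>2"
        by (simp add: power2_eq_square)
      also have "\<dots> < \<delta> * (norm x)\<^sup>2"
        using elim x by (intro mult_strict_right_mono) (auto simp: dist_norm norm_minus_commute)
      finally show ?thesis
        using \<delta>(2)[of x] by (simp add: mat_vec_simps)
    qed
    then show ?case
      using assms(3) by (simp add: posdef_iff)
  qed
qed

section \<open>Recursive functions\<close>

text \<open>Argument lists of fixed length match \<open>eval_recf\<close> and let closure under
  composition be stated once for all arities.\<close>

definition recursive_on :: "nat \<Rightarrow> (nat list \<Rightarrow> nat) \<Rightarrow> bool" where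
  "recursive_on k F \<longleftrightarrow> (\<exists>p. \<forall>xs. length xs = k \<longrightarrow> eval_recf p xs (F xs))"

definition recursive :: "(nat \<Rightarrow> nat) \<Rightarrow> bool" where
  "recursive f \<longleftrightarrow> recursive_on 1 (\<lambda>xs. f (xs ! 0))"

definition recursive2 :: "(nat \<Rightarrow> nat \<Rightarrow> nat) \<Rightarrow> bool" where
  "recursive2 f \<longleftrightarrow> recursive_on 2 (\<lambda>xs. f (xs ! 0) (xs ! 1))"

lemma recursive_iff: "recursive f \<longleftrightarrow> (\<exists>p. \<forall>x. eval_recf p [x] (f x))"
proof -
  have "(\<forall>xs. length xs = 1 \<longrightarrow> eval_recf p xs (f (xs ! 0))) \<longleftrightarrow> (\<forall>x. eval_recf p [x] (f x))" for p
  proof (intro iffI allI impI)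
    show "eval_recf p [x] (f x)" if "\<forall>xs. length xs = 1 \<longrightarrow> eval_recf p xs (f (xs ! 0))" for x
      using that[rule_format, of "[x]"] by simp
    show "eval_recf p xs (f (xs ! 0))" if "\<forall>x. eval_recf p [x] (f x)" "length xs = 1" for xs
      using that by (auto simp: length_Suc_conv)
  qed
  then show ?thesis
    by (simp add: recursive_def recursive_on_def)
qed

lemma recursive2_iff: "recursive2 f \<longleftrightarrow> (\<exists>p. \<forall>x y. eval_recf p [x, y] (f x y))"
proof -
  have "(\<forall>xs. length xs = 2 \<longrightarrow> eval_recf p xs (f (xs ! 0) (xs ! 1))) \<longleftrightarrow>
        (\<forall>x y. eval_recf p [x, y] (f x y))" for p
  proof (intro iffI allI impI)
    show "eval_recf p [x, y] (f x y)"
      if "\<forall>xs. length xs = 2 \<longrightarrow> eval_recf p xs (f (xs ! 0) (xs ! 1))" for x y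
      using that[rule_format, of "[x, y]"] by simp
    show "eval_recf p xs (f (xs ! 0) (xs ! 1))"
      if "\<forall>x y. eval_recf p [x, y] (f x y)" "length xs = 2" for xs
      using that by (auto simp: length_Suc_conv numeral_2_eq_2)
  qed
  then show ?thesis
    by (simp add: recursive2_def recursive_on_def)
qed

lemma recursive_on_proj: "i < k \<Longrightarrow> recursive_on k (\<lambda>xs. xs ! i)"
  unfolding recursive_on_def by (intro exI[of _ "Idf i"]) (auto intro: eval_recf.proj)

lemma recursive_on_comp:
  assumes "recursive h" "recursive_on k F"
  shows "recursive_on k (\<lambda>xs. h (F xs))"
proof -
  obtain p q where p: "\<And>x. eval_recf p [x] (h x)"
    and q: "\<And>xs. length xs = k \<Longrightarrow> eval_recf q xs (F xs)"
    using assms unfolding recursive_iff recursive_on_def by blast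
  have "eval_recf (Cnf p [q]) xs (h (F xs))" if "length xs = k" for xs
    by (rule eval_recf.comp[where ys = "[F xs]"]) (use p q that in auto)
  then show ?thesis
    unfolding recursive_on_def by blast
qed

lemma recursive_on_comp2:
  assumes "recursive2 h" "recursive_on k F" "recursive_on k G"
  shows "recursive_on k (\<lambda>xs. h (F xs) (G xs))"
proof -
  obtain p q r where p: "\<And>x y. eval_recf p [x, y] (h x y)"
    and q: "\<And>xs. length xs = k \<Longrightarrow> eval_recf q xs (F xs)"
    and r: "\<And>xs. length xs = k \<Longrightarrow> eval_recf r xs (G xs)"
    using assms unfolding recursive2_iff recursive_on_def by metis
  have "eval_recf (Cnf p [q, r]) xs (h (F xs) (G xs))" if "length xs = k" for xs
    by (rule eval_recf.comp[where ys = "[F xs, G xs]"]) (use p q r that in auto)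
  then show ?thesis
    unfolding recursive_on_def by blast
qed

lemma recursive_Suc: "recursive Suc"
  unfolding recursive_iff by (intro exI[of _ Sf]) (auto intro: eval_recf.succ)

lemma recursive_on_const: "recursive_on k (\<lambda>xs. c)"
proof (induction c)
  case 0
  show ?case
    unfolding recursive_on_def by (intro exI[of _ Zf]) (auto intro: eval_recf.zero)
next
  case (Suc c)
  then show ?case
    by (rule recursive_on_comp[OF recursive_Suc])
qed

lemma recursive_on_Suc: "recursive_on k F \<Longrightarrow> recursive_on k (\<lambda>xs. Suc (F xs))"
  by (rule recursive_on_comp[OF recursive_Suc])

lemma recursive2_rec_nat:
  assumes "recursive a" "recursive_on 3 (\<lambda>xs. g (xs ! 0) (xs ! 1) (xs ! 2))"
  shows "recursive2 (\<lambda>n x. rec_nat (a x) (\<lambda>m y. g m y x) n)"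
proof -
  obtain p q where p: "\<And>x. eval_recf p [x] (a x)"
    and q: "\<And>xs. length xs = 3 \<Longrightarrow> eval_recf q xs (g (xs ! 0) (xs ! 1) (xs ! 2))"
    using assms unfolding recursive_iff recursive_on_def by metis
  have q': "eval_recf q [m, y, x] (g m y x)" for m y x
    using q[of "[m, y, x]"] by simp
  have "eval_recf (Prf p q) [n, x] (rec_nat (a x) (\<lambda>m y. g m y x) n)" for n x
    by (induction n) (use p q' in \<open>auto intro: eval_recf.pr0 eval_recf.prS\<close>)
  then show ?thesis
    unfolding recursive2_iff by blast
qed

text \<open>\<open>recursive2_rec_nat\<close> carries a parameter; here a dummy one is introduced
  and then set to 0.\<close>

lemma recursive_rec_nat_const:
  assumes "recursive2 g"
  shows "recursive (rec_nat c g)"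
proof -
  have "recursive2 (\<lambda>n x. rec_nat c (\<lambda>m y. g m y) n)"
    by (rule recursive2_rec_nat)
      (auto simp: recursive_def intro!: recursive_on_const recursive_on_comp2[OF assms] recursive_on_proj)
  then have "recursive_on 1 (\<lambda>xs. rec_nat c g (xs ! 0))"
    by (rule recursive_on_comp2[OF _ recursive_on_proj recursive_on_const[where c = 0]]) simp
  then show ?thesis
    by (simp add: recursive_def)
qed

lemma recursive2_add: "recursive2 (+)"
proof -
  have "recursive2 (\<lambda>n x. rec_nat x (\<lambda>m y. Suc y) n)"
    by (rule recursive2_rec_nat)
      (auto simp: recursive_def intro!: recursive_on_proj recursive_on_Suc)
  moreover have "rec_nat x (\<lambda>m y. Suc y) n = n + x" for n x
    by (induction n) auto
  ultimately show ?thesis by simp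
qed

lemma recursive2_mult: "recursive2 (*)"
proof -
  have "recursive2 (\<lambda>n x. rec_nat 0 (\<lambda>m y. y + x) n)"
    by (rule recursive2_rec_nat)
      (auto simp: recursive_def intro!: recursive_on_proj recursive_on_const recursive_on_comp2[OF recursive2_add])
  moreover have "rec_nat 0 (\<lambda>m y. y + x) n = n * x" for n x
    by (induction n) auto
  ultimately show ?thesis by simp
qed

lemma recursive_pred: "recursive (\<lambda>n. n - 1)"
proof -
  have "recursive (rec_nat 0 (\<lambda>m y. m))"
    by (intro recursive_rec_nat_const) (auto simp: recursive2_def intro!: recursive_on_proj)
  moreover have "rec_nat 0 (\<lambda>m y. m) = (\<lambda>n. n - 1)"
  proof
    show "rec_nat 0 (\<lambda>m y. m) n = n - 1" for n
      by (cases n) auto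
  qed
  ultimately show ?thesis
    by (simp only:)
qed

lemma recursive2_diff: "recursive2 (-)"
proof -
  have "recursive2 (\<lambda>n x. rec_nat x (\<lambda>m y. y - 1) n)"
    by (rule recursive2_rec_nat)
      (auto simp: recursive_def intro!: recursive_on_proj recursive_on_comp[OF recursive_pred, simplified])
  moreover have "rec_nat x (\<lambda>m y. y - 1) n = x - n" for n x
    by (induction n) auto
  ultimately have "recursive2 (\<lambda>n x. x - n)" by simp
  \<comment> \<open>The recursion runs on the subtrahend, so the arguments come out swapped;
    projections restore their order.\<close>
  then show ?thesis
    unfolding recursive2_def
    using recursive_on_comp2[OF \<open>recursive2 (\<lambda>n x. x - n)\<close>, of 2 "\<lambda>xs. xs ! 1" "\<lambda>xs. xs ! 0"]
    by (simp add: recursive_on_proj)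
qed

lemma recursive_triangle: "recursive triangle"
proof -
  have "recursive (rec_nat 0 (\<lambda>m y. y + Suc m))"
    by (intro recursive_rec_nat_const)
      (auto simp: recursive2_def simp del: add_Suc_right
        intro!: recursive_on_proj recursive_on_Suc recursive_on_comp2[OF recursive2_add])
  moreover have "rec_nat 0 (\<lambda>m y. y + Suc m) = triangle"
  proof
    show "rec_nat 0 (\<lambda>m y. y + Suc m) n = triangle n" for n
      by (induction n) auto
  qed
  ultimately show ?thesis
    by (simp only:)
qed

text \<open>\<open>Mnf\<close> demands that all values before the zero exist and are positive;
  \<open>P\<close> is total and the least zero is taken.\<close>

lemma recursive_Least:
  assumes "recursive2 P" "\<And>x. \<exists>n. P n x = 0"
  shows "recursive (\<lambda>x. LEAST n. P n x = 0)"
proof -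
  obtain p where p: "\<And>n x. eval_recf p [n, x] (P n x)"
    using assms(1) unfolding recursive2_iff by blast
  have "eval_recf (Mnf p) [x] (LEAST n. P n x = 0)" for x
  proof (rule eval_recf.mn)
    show "eval_recf p [LEAST n. P n x = 0, x] 0"
      using p[of "LEAST n. P n x = 0" x] LeastI_ex[OF assms(2)[of x]] by simp
    show "\<forall>m<LEAST n. P n x = 0. \<exists>y. eval_recf p [m, x] y \<and> 0 < y"
      using p by (blast dest: not_less_Least)
  qed
  then show ?thesis
    unfolding recursive_iff by blast
qed

lemma recursive_id: "recursive (\<lambda>x. x)"
  by (simp add: recursive_def recursive_on_proj)

lemma recursive_const: "recursive (\<lambda>x. c)"
  by (simp add: recursive_def recursive_on_const)

lemma recursive_comp: "recursive f \<Longrightarrow> recursive g \<Longrightarrow> recursive (\<lambda>x. f (g x))"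
  using recursive_on_comp[of f 1 "\<lambda>xs. g (xs ! 0)"] by (simp add: recursive_def)

lemma recursive_comp2:
  "recursive2 h \<Longrightarrow> recursive f \<Longrightarrow> recursive g \<Longrightarrow> recursive (\<lambda>x. h (f x) (g x))"
  using recursive_on_comp2[of h 1 "\<lambda>xs. f (xs ! 0)" "\<lambda>xs. g (xs ! 0)"] by (simp add: recursive_def)

lemmas recursive_add = recursive_comp2[OF recursive2_add]
  and recursive_mult = recursive_comp2[OF recursive2_mult]
  and recursive_diff = recursive_comp2[OF recursive2_diff]
  and recursive_Suc_comp = recursive_comp[OF recursive_Suc]

section \<open>Inverting the pairing function\<close>

abbreviation pfst :: "nat \<Rightarrow> nat" where "pfst z \<equiv> fst (prod_decode z)"
abbreviation psnd :: "nat \<Rightarrow> nat" where "psnd z \<equiv> snd (prod_decode z)"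

lemma mono_triangle: "m \<le> n \<Longrightarrow> triangle m \<le> triangle n"
  by (induction rule: dec_induct) auto

text \<open>\<open>prod_encode (m, n)\<close> is \<open>triangle (m + n) + m\<close> with
  \<open>m \<le> m + n\<close>, so \<open>m + n\<close> is the least \<open>t\<close> with
  \<open>z < triangle (Suc t)\<close>. Truncated subtraction expresses this inequality as a zero
  test.\<close>

lemma pfst_add_psnd: "pfst z + psnd z = (LEAST t. Suc z - triangle (Suc t) = 0)"
proof (rule Least_equality[symmetric])
  obtain m n where mn: "prod_decode z = (m, n)"
    by fastforce
  have z: "z = triangle (m + n) + m"
    using prod_decode_inverse[of z] mn by (simp add: prod_encode_def)
  show "Suc z - triangle (Suc (pfst z + psnd z)) = 0"
    using mn z by simp
  show "pfst z + psnd z \<le> t" if "Suc z - triangle (Suc t) = 0" for t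
  proof (rule ccontr)
    assume "\<not> pfst z + psnd z \<le> t"
    then have "triangle (Suc t) \<le> triangle (m + n)"
      using mn by (intro mono_triangle) simp
    then show False
      using that z by linarith
  qed
qed

lemma pfst_eq: "pfst z = z - triangle (pfst z + psnd z)"
proof -
  obtain m n where mn: "prod_decode z = (m, n)"
    by fastforce
  have "z = triangle (m + n) + m"
    using prod_decode_inverse[of z] mn by (simp add: prod_encode_def)
  then show ?thesis
    using mn by simp
qed

lemma recursive_pfst_add_psnd: "recursive (\<lambda>z. pfst z + psnd z)"
  unfolding pfst_add_psnd
proof (rule recursive_Least)
  show "recursive2 (\<lambda>t z. Suc z - triangle (Suc t))"
    unfolding recursive2_def
    by (intro recursive_on_comp2[OF recursive2_diff] recursive_on_Suc
        recursive_on_comp[OF recursive_triangle] recursive_on_proj) auto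
  show "\<exists>t. Suc z - triangle (Suc t) = 0" for z
    by (rule exI[of _ z]) simp
qed

lemma recursive_pfst: "recursive (\<lambda>z. pfst z)"
proof -
  have "recursive (\<lambda>z. z - triangle (pfst z + psnd z))"
    by (rule recursive_diff[OF recursive_id recursive_comp[OF recursive_triangle recursive_pfst_add_psnd]])
  then show ?thesis
    by (simp only: pfst_eq[symmetric])
qed

lemma recursive_psnd: "recursive (\<lambda>z. psnd z)"
proof -
  have "recursive (\<lambda>z. (pfst z + psnd z) - pfst z)"
    by (intro recursive_diff recursive_pfst recursive_pfst_add_psnd)
  then show ?thesis by simp
qed

lemma recursive_on_prod_encode:
  "recursive_on k F \<Longrightarrow> recursive_on k G \<Longrightarrow> recursive_on k (\<lambda>xs. prod_encode (F xs, G xs))"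
  unfolding prod_encode_def prod.case
  by (intro recursive_on_comp2[OF recursive2_add] recursive_on_comp[OF recursive_triangle])

lemma recursive_prod_encode:
  "recursive f \<Longrightarrow> recursive g \<Longrightarrow> recursive (\<lambda>x. prod_encode (f x, g x))"
  unfolding recursive_def by (rule recursive_on_prod_encode)

lemma recursive_pfst_comp: "recursive f \<Longrightarrow> recursive (\<lambda>x. pfst (f x))"
  by (rule recursive_comp[OF recursive_pfst])

lemma recursive_psnd_comp: "recursive f \<Longrightarrow> recursive (\<lambda>x. psnd (f x))"
  by (rule recursive_comp[OF recursive_psnd])

lemma recursive_If_zero:
  assumes "recursive c" "recursive f" "recursive g"
  shows "recursive (\<lambda>x. if c x = 0 then f x else g x)"
proof -
  \<comment> \<open>In truncated subtraction \<open>1 - c x\<close> is the indicator of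
    \<open>c x = 0\<close>.\<close>
  have "recursive (\<lambda>x. (1 - c x) * f x + (1 - (1 - c x)) * g x)"
    by (intro recursive_add recursive_mult recursive_diff recursive_const assms)
  moreover have "(1 - c x) * f x + (1 - (1 - c x)) * g x = (if c x = 0 then f x else g x)" for x
    by simp
  ultimately show ?thesis by simp
qed

text \<open>A test succeeds with the value 0, so that it can be fed to unbounded minimisation.\<close>

definition decidable :: "(nat \<Rightarrow> bool) \<Rightarrow> bool" where
  "decidable P \<longleftrightarrow> recursive (\<lambda>x. of_bool (\<not> P x))"

lemma decidable_less:
  assumes "recursive f" "recursive g"
  shows "decidable (\<lambda>x. f x < g x)"
proof -
  have "recursive (\<lambda>x. 1 - (g x - f x))"
    by (intro recursive_diff recursive_const assms)
  moreover have "1 - (g x - f x) = of_bool (\<not> f x < g x)" for x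
    by simp
  ultimately show ?thesis
    by (simp add: decidable_def)
qed

lemma recursive_If:
  assumes "decidable P" "recursive f" "recursive g"
  shows "recursive (\<lambda>x. if P x then f x else g x)"
proof -
  have "(if of_bool (\<not> P x) = (0::nat) then f x else g x) = (if P x then f x else g x)" for x
    by simp
  then show ?thesis
    using recursive_If_zero[OF assms[unfolded decidable_def]] by presburger
qed

lemma recursive_funpow:
  assumes "recursive h" "recursive n" "recursive a"
  shows "recursive (\<lambda>x. (h ^^ n x) (a x))"
proof -
  have "recursive2 (\<lambda>n x. rec_nat (a x) (\<lambda>m y. h y) n)"
    by (rule recursive2_rec_nat) (auto intro!: recursive_on_comp[OF assms(1)] recursive_on_proj assms)
  moreover have "rec_nat (a x) (\<lambda>m y. h y) n = (h ^^ n) (a x)" for n x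
    by (induction n) auto
  ultimately have "recursive2 (\<lambda>n x. (h ^^ n) (a x))"
    by simp
  then show ?thesis
    by (rule recursive_comp2) (auto intro: assms recursive_id)
qed

lemma recursive_power2: "recursive (\<lambda>x. 2 ^ x)"
proof -
  have "recursive (\<lambda>x. ((*) 2 ^^ x) 1)"
    by (intro recursive_funpow recursive_mult recursive_const recursive_id)
  moreover have "((*) 2 ^^ x) 1 = (2::nat) ^ x" for x
    by (induction x) auto
  ultimately show ?thesis by simp
qed

lemma recursive_div2: "recursive (\<lambda>x. x div 2)"
proof -
  \<comment> \<open>The zero test says \<open>x < 2 * (n + 1)\<close>.\<close>
  have "x div 2 = (LEAST n. Suc x - 2 * Suc n = 0)" for x :: nat
    by (rule Least_equality[symmetric]) presburger+
  moreover have "recursive (\<lambda>x. LEAST n. Suc x - 2 * Suc n = 0)"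
  proof (rule recursive_Least)
    show "recursive2 (\<lambda>n x. Suc x - 2 * Suc n)"
      unfolding recursive2_def
      by (intro recursive_on_comp2[OF recursive2_diff] recursive_on_Suc
          recursive_on_comp2[OF recursive2_mult] recursive_on_proj recursive_on_const) auto
    show "\<exists>n. Suc x - 2 * Suc n = 0" for x
      by (rule exI[of _ x]) simp
  qed
  ultimately show ?thesis by simp
qed

text \<open>The search for \<open>w\<close> need only succeed along the orbit \<open>Y\<close>, not for arbitrary \<open>n\<close>, \<open>y\<close>, \<open>e\<close>.\<close>

lemma recursive_search_sequence:
  assumes P: "decidable (\<lambda>z. P (pfst z) (pfst (psnd z)) (pfst (psnd (psnd z))) (psnd (psnd (psnd z))))"
    and h: "recursive (\<lambda>z. h (pfst z) (pfst (psnd z)) (pfst (psnd (psnd z))) (psnd (psnd (psnd z))))"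
    and ex: "\<And>n e. \<exists>w. P w n (Y n e) e"
    and Y0: "\<And>e. Y 0 e = 0"
    and YS: "\<And>n e. Y (Suc n) e = h (LEAST w. P w n (Y n e) e) n (Y n e) e"
  shows "recursive (\<lambda>z. Y (pfst z) (psnd z))"
proof -
  \<comment> \<open>The unary assumptions on nested pairs are turned into programs with four
    separate arguments, as \<open>Mnf\<close> and \<open>Prf\<close> expect.\<close>
  have enc: "recursive_on 4 (\<lambda>xs. prod_encode (xs ! 0, prod_encode (xs ! 1, prod_encode (xs ! 2, xs ! 3))))"
    by (intro recursive_on_prod_encode recursive_on_proj) auto
  obtain p where p: "\<And>xs. length xs = 4 \<Longrightarrow> eval_recf p xs (of_bool (\<not> P (xs ! 0) (xs ! 1) (xs ! 2) (xs ! 3)))"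
    using recursive_on_comp[OF P[unfolded decidable_def] enc] unfolding recursive_on_def by auto
  obtain q where q: "\<And>xs. length xs = 4 \<Longrightarrow> eval_recf q xs (h (xs ! 0) (xs ! 1) (xs ! 2) (xs ! 3))"
    using recursive_on_comp[OF h enc] unfolding recursive_on_def by auto
  have p': "eval_recf p [w, n, y, e] (of_bool (\<not> P w n y e))"
    and q': "eval_recf q [w, n, y, e] (h w n y e)" for w n y e
    using p[of "[w, n, y, e]"] q[of "[w, n, y, e]"] by (auto simp: numeral_3_eq_3)
  have least: "eval_recf (Mnf p) [n, Y n e, e] (LEAST w. P w n (Y n e) e)" for n e
  proof (rule eval_recf.mn)
    show "eval_recf p [LEAST w. P w n (Y n e) e, n, Y n e, e] 0"
      using p'[of "LEAST w. P w n (Y n e) e" n "Y n e" e] LeastI_ex[OF ex[of n e]] by simp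
    show "\<forall>m<LEAST w. P w n (Y n e) e. \<exists>y. eval_recf p [m, n, Y n e, e] y \<and> 0 < y"
    proof (intro allI impI)
      fix m assume "m < (LEAST w. P w n (Y n e) e)"
      then have "\<not> P m n (Y n e) e"
        by (rule not_less_Least)
      then show "\<exists>y. eval_recf p [m, n, Y n e, e] y \<and> 0 < y"
        using p'[of m n "Y n e" e] by auto
    qed
  qed
  \<comment> \<open>On \<open>n\<close>, \<open>Y n e\<close>, \<open>e\<close> the step first
    searches for \<open>w\<close>, then passes it with these three values to \<open>h\<close>. The
    base program \<open>Zf\<close> matches \<open>Y 0 e = 0\<close>.\<close>
  define r where "r = Prf Zf (Cnf q [Mnf p, Idf 0, Idf 1, Idf 2])"
  have "eval_recf r [n, e] (Y n e)" for n e
  proof (induction n)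
    case 0
    show ?case
      unfolding r_def Y0 by (intro eval_recf.pr0 eval_recf.zero)
  next
    case (Suc n)
    have proj: "eval_recf (Idf i) [n, Y n e, e] ([n, Y n e, e] ! i)" if "i < 3" for i
      using that by (intro eval_recf.proj) simp
    have "eval_recf (Cnf q [Mnf p, Idf 0, Idf 1, Idf 2]) [n, Y n e, e] (Y (Suc n) e)"
      unfolding YS
      by (rule eval_recf.comp[where ys = "[LEAST w. P w n (Y n e) e, n, Y n e, e]"])
        (use least q' proj[of 0] proj[of 1] proj[of 2] in auto)
    then show ?case
      using Suc unfolding r_def by (rule eval_recf.prS[rotated])
  qed
  then have "recursive2 Y"
    unfolding recursive2_iff by blast
  then show ?thesis
    by (rule recursive_comp2[OF _ recursive_pfst recursive_psnd])
qed

section \<open>Recursive rational-valued functions\<close>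

text \<open>A difference in the numerator provides signs and a successor in the denominator excludes
  zero, so only recursive functions on natural numbers occur.\<close>

definition rat_recursive :: "(nat \<Rightarrow> real) \<Rightarrow> bool" where
  "rat_recursive r \<longleftrightarrow> (\<exists>p q d. recursive p \<and> recursive q \<and> recursive d \<and>
     (\<forall>x. r x = (real (p x) - real (q x)) / real (Suc (d x))))"

lemma rat_recursiveI:
  assumes "recursive p" "recursive q" "recursive d"
    and "\<And>x. r x = (real (p x) - real (q x)) / real (Suc (d x))"
  shows "rat_recursive r"
  using assms unfolding rat_recursive_def by blast

lemma rat_recursive_of_nat: "recursive f \<Longrightarrow> rat_recursive (\<lambda>x. real (f x))"
  by (rule rat_recursiveI[of f "\<lambda>x. 0" "\<lambda>x. 0"]) (auto intro: recursive_const)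

lemma rat_recursive_inverse_Suc: "recursive f \<Longrightarrow> rat_recursive (\<lambda>x. 1 / real (Suc (f x)))"
  by (rule rat_recursiveI[of "\<lambda>x. 1" "\<lambda>x. 0" f]) (auto intro: recursive_const)

lemma rat_recursive_0: "rat_recursive (\<lambda>x. 0)"
  and rat_recursive_1: "rat_recursive (\<lambda>x. 1)"
  using rat_recursive_of_nat[OF recursive_const[of 0]] rat_recursive_of_nat[OF recursive_const[of 1]]
  by auto

lemma rat_recursive_diff:
  assumes "rat_recursive r" "rat_recursive s"
  shows "rat_recursive (\<lambda>x. r x - s x)"
proof -
  obtain p q d p' q' d' where rec: "recursive p" "recursive q" "recursive d"
      "recursive p'" "recursive q'" "recursive d'"
    and r: "\<And>x. r x = (real (p x) - real (q x)) / real (Suc (d x))"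
    and s: "\<And>x. s x = (real (p' x) - real (q' x)) / real (Suc (d' x))"
    using assms unfolding rat_recursive_def by metis
  show ?thesis
  proof (rule rat_recursiveI)
    show "recursive (\<lambda>x. p x * Suc (d' x) + q' x * Suc (d x))"
         "recursive (\<lambda>x. q x * Suc (d' x) + p' x * Suc (d x))"
         "recursive (\<lambda>x. d x * Suc (d' x) + d' x)"
      by (intro recursive_add recursive_mult recursive_Suc_comp rec)+
    show "r x - s x = (real (p x * Suc (d' x) + q' x * Suc (d x))
        - real (q x * Suc (d' x) + p' x * Suc (d x))) / real (Suc (d x * Suc (d' x) + d' x))" for x
    proof -
      have "real (Suc (d x * Suc (d' x) + d' x)) = real (Suc (d x)) * real (Suc (d' x))"
        by (simp add: algebra_simps)
      moreover have "(a - b) / u - (a' - b') / v = ((a * v + b' * u) - (b * v + a' * u)) / (u * v)"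
        if "u \<noteq> 0" "v \<noteq> 0" for a b u a' b' v :: real
        using that by (simp add: field_simps)
      ultimately show ?thesis
        unfolding r s of_nat_add of_nat_mult by (simp del: of_nat_Suc)
    qed
  qed
qed

lemma rat_recursive_mult:
  assumes "rat_recursive r" "rat_recursive s"
  shows "rat_recursive (\<lambda>x. r x * s x)"
proof -
  obtain p q d p' q' d' where rec: "recursive p" "recursive q" "recursive d"
      "recursive p'" "recursive q'" "recursive d'"
    and r: "\<And>x. r x = (real (p x) - real (q x)) / real (Suc (d x))"
    and s: "\<And>x. s x = (real (p' x) - real (q' x)) / real (Suc (d' x))"
    using assms unfolding rat_recursive_def by metis
  show ?thesis
  proof (rule rat_recursiveI)
    show "recursive (\<lambda>x. p x * p' x + q x * q' x)" "recursive (\<lambda>x. p x * q' x + q x * p' x)"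
         "recursive (\<lambda>x. d x * Suc (d' x) + d' x)"
      by (intro recursive_add recursive_mult recursive_Suc_comp rec)+
    show "r x * s x = (real (p x * p' x + q x * q' x) - real (p x * q' x + q x * p' x))
        / real (Suc (d x * Suc (d' x) + d' x))" for x
    proof -
      have "real (Suc (d x * Suc (d' x) + d' x)) = real (Suc (d x)) * real (Suc (d' x))"
        by (simp add: algebra_simps)
      then show ?thesis
        unfolding r s by (simp add: algebra_simps del: of_nat_Suc)
    qed
  qed
qed

lemma rat_recursive_add:
  assumes "rat_recursive r" "rat_recursive s"
  shows "rat_recursive (\<lambda>x. r x + s x)"
  using rat_recursive_diff[OF assms(1) rat_recursive_diff[OF rat_recursive_0 assms(2)]] by simp

lemma rat_recursive_sum:
  "finite I \<Longrightarrow> (\<And>i. i \<in> I \<Longrightarrow> rat_recursive (r i)) \<Longrightarrow> rat_recursive (\<lambda>x. \<Sum>i\<in>I. r i x)"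
  by (induction I rule: finite_induct) (auto intro: rat_recursive_0 rat_recursive_add)

lemma rat_recursive_comp:
  assumes "rat_recursive r" "recursive f"
  shows "rat_recursive (\<lambda>x. r (f x))"
proof -
  obtain p q d where "recursive p" "recursive q" "recursive d"
    and "\<And>x. r x = (real (p x) - real (q x)) / real (Suc (d x))"
    using assms unfolding rat_recursive_def by metis
  with assms(2) show ?thesis
    by (intro rat_recursiveI[of "\<lambda>x. p (f x)" "\<lambda>x. q (f x)" "\<lambda>x. d (f x)"]) (auto intro: recursive_comp)
qed

text \<open>The denominator of \<open>r x - s x\<close> is positive, so its sign is decided by
  comparing two natural numbers.\<close>

lemma decidable_rat_less:
  assumes "rat_recursive r" "rat_recursive s"
  shows "decidable (\<lambda>x. r x < s x)"
proof -
  obtain p q d where rec: "recursive p" "recursive q" "recursive d"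
    and r: "\<And>x. r x - s x = (real (p x) - real (q x)) / real (Suc (d x))"
    using rat_recursive_diff[OF assms] unfolding rat_recursive_def by metis
  have "r x < s x \<longleftrightarrow> p x < q x" for x
  proof -
    have "r x < s x \<longleftrightarrow> r x - s x < 0" by simp
    also have "\<dots> \<longleftrightarrow> p x < q x"
      unfolding r by (simp add: divide_less_0_iff del: of_nat_Suc)
    finally show ?thesis .
  qed
  then show ?thesis
    using decidable_less[OF rec(1,2)] by simp
qed

text \<open>Evenness appears as an inequality involving \<open>div\<close>, the form to which
  \<open>decidable_less\<close> and \<open>recursive_div2\<close> apply.\<close>

lemma int_decode_parity:
  "int_decode n = (if n < Suc (2 * (n div 2)) then int (n div 2) else - int (Suc (n div 2)))"
proof -
  have "n < Suc (2 * (n div 2)) \<longleftrightarrow> even n"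
    by presburger
  then show ?thesis
    unfolding int_decode_def sum_decode_def by (simp only: split: if_split) simp
qed

lemma rat_recursive_rat_dec: "rat_recursive rat_dec"
proof (rule rat_recursiveI)
  let ?a = "\<lambda>x. pfst x" and ?b = "\<lambda>x. psnd x"
  let ?even = "\<lambda>x. ?a x < Suc (2 * (?a x div 2))"
  \<comment> \<open>A coded denominator 0 makes \<open>rat_dec\<close> equal to 0, as division by
    zero yields 0. The guard reproduces this value, over the denominator
    \<open>Suc (0 - 1) = 1\<close>.\<close>
  let ?p = "\<lambda>x. if 0 < ?b x then if ?even x then ?a x div 2 else 0 else 0"
  let ?q = "\<lambda>x. if 0 < ?b x then if ?even x then 0 else Suc (?a x div 2) else 0"
  have "decidable ?even"
    by (intro decidable_less recursive_Suc_comp recursive_mult recursive_const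
        recursive_comp[OF recursive_div2] recursive_pfst)
  then show "recursive ?p" "recursive ?q" "recursive (\<lambda>x. ?b x - 1)"
    by (intro recursive_If decidable_less recursive_const recursive_diff recursive_Suc_comp
        recursive_mult recursive_comp[OF recursive_div2] recursive_pfst recursive_psnd)+
  show "rat_dec x = (real (?p x) - real (?q x)) / real (Suc (?b x - 1))" for x
    unfolding rat_dec_def by (cases "?b x") (auto simp: int_decode_parity split: prod.split)
qed

lemma rat_recursive_code:
  assumes "rat_recursive r"
  obtains g where "recursive g" "\<And>x. rat_dec (g x) = r x"
proof -
  obtain p q d where rec: "recursive p" "recursive q" "recursive d"
    and r: "\<And>x. r x = (real (p x) - real (q x)) / real (Suc (d x))"
    using assms unfolding rat_recursive_def by metis
  \<comment> \<open>\<open>int_decode\<close> reads \<open>2 * k\<close> as \<open>k\<close> and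
    \<open>2 * k - 1\<close>, for positive \<open>k\<close>, as \<open>- k\<close>.\<close>
  define n where "n = (\<lambda>x. if p x < q x then 2 * (q x - p x) - 1 else 2 * (p x - q x))"
  have n: "int_decode (n x) = int (p x) - int (q x)" for x
  proof (cases "p x < q x")
    case True
    then obtain k where "q x = p x + Suc k"
      using less_imp_Suc_add by auto
    then show ?thesis
      by (simp add: n_def int_decode_def sum_decode_def)
  qed (simp add: n_def int_decode_def sum_decode_def)
  show thesis
  proof
    show "recursive (\<lambda>x. prod_encode (n x, Suc (d x)))"
      unfolding n_def
      by (intro recursive_prod_encode recursive_If decidable_less recursive_diff recursive_mult
          recursive_const recursive_Suc_comp rec)
    show "rat_dec (prod_encode (n x, Suc (d x))) = r x" for x
      by (simp add: rat_dec_def n r)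
  qed
qed

section \<open>Recursive matrix-valued functions and their codes\<close>

definition mat_recursive :: "(nat \<Rightarrow> 'n::finite cmat) \<Rightarrow> bool" where
  "mat_recursive A \<longleftrightarrow>
     (\<forall>i j. rat_recursive (\<lambda>x. Re (A x $ i $ j)) \<and> rat_recursive (\<lambda>x. Im (A x $ i $ j)))"

lemma mat_recursive_comp: "mat_recursive A \<Longrightarrow> recursive f \<Longrightarrow> mat_recursive (\<lambda>x. A (f x))"
  using rat_recursive_comp unfolding mat_recursive_def by blast

lemma mat_recursive_diff: "mat_recursive A \<Longrightarrow> mat_recursive B \<Longrightarrow> mat_recursive (\<lambda>x. A x - B x)"
  unfolding mat_recursive_def by (simp add: rat_recursive_diff)

lemma mat_recursive_scaleR:
  "rat_recursive r \<Longrightarrow> mat_recursive A \<Longrightarrow> mat_recursive (\<lambda>x. r x *\<^sub>R A x)"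
  unfolding mat_recursive_def by (simp add: rat_recursive_mult)

lemma mat_recursive_mat: "mat_recursive (\<lambda>x. mat 1)"
  unfolding mat_recursive_def
  by (auto simp: mat_def rat_recursive_0 rat_recursive_1)

lemma mat_recursive_matrix_mult:
  "mat_recursive A \<Longrightarrow> mat_recursive B \<Longrightarrow> mat_recursive (\<lambda>x. A x ** B x)"
  unfolding mat_recursive_def
  by (simp add: matrix_matrix_mult_def rat_recursive_sum rat_recursive_add rat_recursive_diff
      rat_recursive_mult)

text \<open>Comparison with 1 allows the square root to be dropped, leaving a polynomial in the
  rational entries.\<close>

lemma decidable_norm_less_1:
  assumes "mat_recursive A"
  shows "decidable (\<lambda>x. norm (A x) < 1)"
proof -
  have "norm (A x) < 1 \<longleftrightarrow> (\<Sum>i\<in>UNIV. \<Sum>j\<in>UNIV.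
      Re (A x $ i $ j) * Re (A x $ i $ j) + Im (A x $ i $ j) * Im (A x $ i $ j)) < 1" for x
    by (simp add: norm_vec_def L2_set_def sum_nonneg real_sqrt_lt_1_iff cmod_power2
        power2_eq_square[of "Re _"] power2_eq_square[of "Im _"])
  moreover have "decidable (\<lambda>x. (\<Sum>i\<in>UNIV. \<Sum>j\<in>UNIV.
      Re (A x $ i $ j) * Re (A x $ i $ j) + Im (A x $ i $ j) * Im (A x $ i $ j)) < 1)"
    using assms unfolding mat_recursive_def
    by (intro decidable_rat_less rat_recursive_sum rat_recursive_add rat_recursive_mult rat_recursive_1) auto
  ultimately show ?thesis by simp
qed

text \<open>A nonzero code is the successor of a pair of head and tail code, so entry
  \<open>m\<close> is found after \<open>m\<close> tails. The tail of code 0 is again 0, in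
  accordance with the default entry.\<close>

lemma recursive_nth_default_list_decode: "recursive (\<lambda>x. nth_default 0 (list_decode x) m)"
proof (induction m)
  case 0
  have "nth_default 0 (list_decode x) 0 = (if x = 0 then 0 else pfst (x - 1))" for x
    by (cases x) (auto split: prod.split)
  moreover have "recursive (\<lambda>x. if x = 0 then 0 else pfst (x - 1))"
    by (intro recursive_If_zero recursive_id recursive_const recursive_pfst_comp recursive_diff)
  ultimately show ?case by simp
next
  case (Suc m)
  define tail where "tail = (\<lambda>x. if x = 0 then 0 else psnd (x - 1))"
  have "nth_default 0 (list_decode x) (Suc m) = nth_default 0 (list_decode (tail x)) m" for x
    by (cases x) (auto simp: tail_def split: prod.split)
  moreover have "recursive tail"
    unfolding tail_def
    by (intro recursive_If_zero recursive_id recursive_const recursive_psnd_comp recursive_diff)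
  ultimately show ?case
    using recursive_comp[OF Suc] by simp
qed

lemma recursive_list_encode:
  "(\<And>c. c \<in> set cs \<Longrightarrow> recursive c) \<Longrightarrow> recursive (\<lambda>x. list_encode (map (\<lambda>c. c x) cs))"
proof (induction cs)
  case Nil
  show ?case
    by (simp add: recursive_const)
next
  case (Cons c cs)
  then have "recursive (\<lambda>x. Suc (prod_encode (c x, list_encode (map (\<lambda>c. c x) cs))))"
    by (intro recursive_Suc_comp recursive_prod_encode) auto
  then show ?case by simp
qed

lemma mat_recursive_mat_dec: "mat_recursive (mat_dec :: nat \<Rightarrow> 'n::enum cmat)"
proof -
  have "rat_recursive (\<lambda>x. Re (gq_dec x))" "rat_recursive (\<lambda>x. Im (gq_dec x))"
    using rat_recursive_comp[OF rat_recursive_rat_dec recursive_pfst]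
      rat_recursive_comp[OF rat_recursive_rat_dec recursive_psnd]
    by (simp_all add: gq_dec_def case_prod_beta)
  then show ?thesis
    unfolding mat_recursive_def mat_dec_def
    by (auto intro: rat_recursive_comp recursive_nth_default_list_decode)
qed

text \<open>The description in \<open>idx\<close> is proper because \<open>enum\<close> is distinct
  and exhausts the type.\<close>

lemma idx_less: "idx (i :: 'n::enum) < CARD('n)"
  and enum_nth_idx: "enum_class.enum ! idx i = i"
proof -
  have "\<exists>!k. k < length (enum_class.enum :: 'n list) \<and> enum_class.enum ! k = i"
    using enum_distinct enum_UNIV by (metis UNIV_I in_set_conv_nth nth_eq_iff_index_eq)
  from theI'[OF this] show "idx i < CARD('n)" "enum_class.enum ! idx i = i"
    by (auto simp: idx_def card_UNIV_length_enum)
qed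

text \<open>The bridge from entrywise arithmetic back to single codes, which programs output and
  recursions can carry as state.\<close>

lemma mat_recursive_code:
  fixes A :: "nat \<Rightarrow> 'n::enum cmat"
  assumes "mat_recursive A"
  obtains g where "recursive g" "\<And>x. mat_dec (g x) = A x"
proof -
  have "\<exists>c. recursive c \<and> (\<forall>x. gq_dec (c x) = A x $ i $ j)" for i j
  proof -
    obtain a where "recursive a" "\<And>x. rat_dec (a x) = Re (A x $ i $ j)"
      using rat_recursive_code[of "\<lambda>x. Re (A x $ i $ j)"] assms
      unfolding mat_recursive_def by blast
    moreover obtain b where "recursive b" "\<And>x. rat_dec (b x) = Im (A x $ i $ j)"
      using rat_recursive_code[of "\<lambda>x. Im (A x $ i $ j)"] assms
      unfolding mat_recursive_def by blast
    ultimately show ?thesis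
      by (intro exI[of _ "\<lambda>x. prod_encode (a x, b x)"])
        (auto simp: gq_dec_def complex_eq_iff intro: recursive_prod_encode)
  qed
  then obtain c where c: "\<And>i j. recursive (c i j)" "\<And>i j x. gq_dec (c i j x) = A x $ i $ j"
    by metis
  define N where "N = CARD('n)"
  \<comment> \<open>Row-major order, as in \<open>mat_dec\<close>: quotient and remainder by
    \<open>N\<close> recover row and column.\<close>
  define cs where "cs = map (\<lambda>m. c (enum_class.enum ! (m div N)) (enum_class.enum ! (m mod N))) [0..<N * N]"
  show thesis
  proof
    show "recursive (\<lambda>x. list_encode (map (\<lambda>c. c x) cs))"
      by (rule recursive_list_encode) (auto simp: cs_def c)
    show "mat_dec (list_encode (map (\<lambda>c. c x) cs)) = A x" for x
    proof -
      have "nth_default 0 (map (\<lambda>c. c x) cs) (idx i * N + idx j) = c i j x" for i j :: 'n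
      proof -
        have i: "idx i < N" and j: "idx j < N"
          by (simp_all add: N_def idx_less)
        have "idx i * N + idx j < Suc (idx i) * N"
          using j by simp
        also have "\<dots> \<le> N * N"
          using i by (intro mult_right_mono) auto
        finally have "idx i * N + idx j < N * N" .
        then show ?thesis
          using i j by (simp add: nth_default_def cs_def enum_nth_idx)
      qed
      then show ?thesis
        by (simp add: mat_dec_def vec_eq_iff c flip: N_def)
    qed
  qed
qed

text \<open>The number of iterations depends on the input, so closure under \<open>\<phi>\<close>
  alone is not enough: a function \<open>h\<close> on codes that simulates \<open>\<phi>\<close> is
  iterated and the result decoded.\<close>

lemma mat_recursive_funpow:
  fixes \<phi> :: "'n::enum cmat \<Rightarrow> 'n cmat"
  assumes "mat_recursive (\<lambda>y. \<phi> (mat_dec y))" "mat_recursive A" "recursive n"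
  shows "mat_recursive (\<lambda>x. (\<phi> ^^ n x) (A x))"
proof -
  obtain h where h: "recursive h" "\<And>y. mat_dec (h y) = \<phi> (mat_dec y)"
    using mat_recursive_code[OF assms(1)] by blast
  obtain a where a: "recursive a" "\<And>x. mat_dec (a x) = A x"
    using mat_recursive_code[OF assms(2)] by blast
  have "mat_dec ((h ^^ k) y) = (\<phi> ^^ k) (mat_dec y)" for k y
    by (induction k) (auto simp: h)
  moreover have "mat_recursive (\<lambda>x. mat_dec ((h ^^ n x) (a x)) :: 'n cmat)"
    by (intro mat_recursive_comp[OF mat_recursive_mat_dec] recursive_funpow h a assms)
  ultimately show ?thesis
    by (simp add: a)
qed

section \<open>Strings as numbers, and recursiveness of matrix families\<close>

lemma surj_bl_enc: "\<exists>s. bl_enc s = n"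
proof (induction n rule: less_induct)
  case (less n)
  show ?case
  proof (cases n)
    case 0
    then show ?thesis by (intro exI[of _ "[]"]) simp
  next
    case (Suc m)
    then obtain s where "bl_enc s = m div 2"
      using less[of "m div 2"] by (auto simp: less_Suc_eq_le)
    then show ?thesis
      using Suc by (intro exI[of _ "odd m # s"]) (auto simp: odd_two_times_div_two_succ)
  qed
qed

text \<open>\<open>bl_enc\<close> is base-2 notation with digits 1 and 2, so the parity of a nonzero
  code determines the first bit.\<close>

lemma inj_bl_enc: "inj bl_enc"
proof (rule injI)
  show "s = t" if "bl_enc s = bl_enc t" for s t
    using that
  proof (induction s arbitrary: t)
    case Nil
    then show ?case by (cases t) auto
  next
    case (Cons a s)
    then obtain b t' where t: "t = b # t'"
      by (cases t) auto
    then have eq: "of_bool a + 2 * bl_enc s = of_bool b + 2 * bl_enc t'"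
      using Cons.prems by simp
    then have "odd (of_bool a + 2 * bl_enc s) \<longleftrightarrow> odd (of_bool b + 2 * bl_enc t')"
      by (simp only:)
    then have "a = b"
      by simp
    then show ?case
      using eq Cons.IH t by simp
  qed
qed

text \<open>Every number encodes exactly one pair of index and string, so a program for
  \<open>F\<close> has an output on all numbers. As \<open>eval_recf\<close> is a relation, suitable
  outputs are collected into a function \<open>g\<close> by choice.\<close>

lemma total_recursive_mat_iff:
  fixes F :: "nat \<Rightarrow> bool list \<Rightarrow> 'n::enum cmat"
  shows "total_recursive_mat F \<longleftrightarrow> (\<exists>A. mat_recursive A \<and> (\<forall>n s. A (prod_encode (n, bl_enc s)) = F n s))"
proof
  assume "total_recursive_mat F"
  then obtain p where p: "\<And>n s. \<exists>y. eval_recf p [prod_encode (n, bl_enc s)] y \<and> mat_dec y = F n s"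
    unfolding total_recursive_mat_def by blast
  have "\<exists>y. eval_recf p [x] y \<and> (\<forall>n s. x = prod_encode (n, bl_enc s) \<longrightarrow> mat_dec y = F n s)" for x
  proof -
    obtain n s where x: "x = prod_encode (n, bl_enc s)"
      using surj_bl_enc[of "psnd x"] prod_decode_inverse[of x] by (metis prod.collapse)
    obtain y where "eval_recf p [x] y" "mat_dec y = F n s"
      using p[of n s] x by blast
    moreover have "m = n \<and> t = s" if "x = prod_encode (m, bl_enc t)" for m t
      using that x injD[OF inj_bl_enc, of t s] by simp
    ultimately show ?thesis
      by blast
  qed
  then obtain g where g: "\<And>x. eval_recf p [x] (g x)"
    "\<And>n s. mat_dec (g (prod_encode (n, bl_enc s))) = F n s"
    by metis
  then have "recursive g"
    unfolding recursive_iff by blast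
  then show "\<exists>A. mat_recursive A \<and> (\<forall>n s. A (prod_encode (n, bl_enc s)) = F n s)"
    using g(2) mat_recursive_comp[OF mat_recursive_mat_dec] by blast
next
  assume "\<exists>A. mat_recursive A \<and> (\<forall>n s. A (prod_encode (n, bl_enc s)) = F n s)"
  then obtain A where A: "mat_recursive A" "\<And>n s. A (prod_encode (n, bl_enc s)) = F n s"
    by blast
  obtain g where g: "recursive g" "\<And>x. mat_dec (g x) = A x"
    using mat_recursive_code[OF A(1)] by blast
  obtain p where p: "\<And>x. eval_recf p [x] (g x)"
    using g(1) unfolding recursive_iff by blast
  show "total_recursive_mat F"
    unfolding total_recursive_mat_def
  proof (intro exI allI conjI)
    show "eval_recf p [prod_encode (n, bl_enc s)] (g (prod_encode (n, bl_enc s)))" for n s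
      by (rule p)
    show "mat_dec (g (prod_encode (n, bl_enc s))) = F n s" for n s
      by (simp add: g A(2))
  qed
qed

section \<open>Families dominated by a semi-POVM\<close>

lemma inner_axis_matrix_axis:
  fixes A :: "'n::finite cmat"
  shows "axis i a \<bullet> (A *v axis j b) = Re (cnj a * (A $ i $ j * b))"
proof -
  have "(A *v axis j b) $ k = A $ k $ j * b" for k
    by (simp add: matrix_vector_mult_def axis_def if_distrib cong: if_cong)
  then show ?thesis
    by (simp add: inner_axis' inner_complex_def)
qed

text \<open>The quadratic form at \<open>e_i - u * e_j\<close>, with a phase \<open>u\<close>
  rotating \<open>A $ i $ j\<close> onto the nonnegative reals, equals the two diagonal entries
  minus twice the modulus.\<close>

lemma psd_entry_le:
  fixes A :: "'n::finite cmat"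
  assumes "psd A"
  shows "norm (A $ i $ j) \<le> (Re (A $ i $ i) + Re (A $ j $ j)) / 2"
proof -
  have nonneg: "0 \<le> x \<bullet> (A *v x)" for x
    using assms by (simp add: psd_iff)
  define z where "z = A $ i $ j"
  define u where "u = (if z = 0 then 1 else cnj z / norm z)"
  have sq: "z * cnj z = complex_of_real (norm z) * complex_of_real (norm z)"
    using complex_norm_square[of z] by (simp add: power2_eq_square)
  have u: "cnj u * u = 1"
    by (auto simp: u_def sq)
  have zu: "Re (z * u) = norm z"
  proof (cases "z = 0")
    case False
    have "z * u = (z * cnj z) / norm z"
      using False by (simp add: u_def)
    also have "\<dots> = complex_of_real (norm z)"
      using False by (simp add: sq)
    finally show ?thesis by simp
  qed (simp add: u_def)
  let ?e = "axis i 1 :: complex^'n" and ?f = "axis j u :: complex^'n"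
  have swap: "?f \<bullet> (A *v ?e) = ?e \<bullet> (A *v ?f)"
    using hermitian_inner_swap[of A ?f ?e] assms by (simp add: psd_iff inner_commute)
  have "0 \<le> (?e - ?f) \<bullet> (A *v (?e - ?f))"
    by (rule nonneg)
  also have "\<dots> = ?e \<bullet> (A *v ?e) - 2 * (?e \<bullet> (A *v ?f)) + ?f \<bullet> (A *v ?f)"
    by (simp add: matrix_vector_mult_diff_distrib inner_diff_left inner_diff_right swap)
  also have "?f \<bullet> (A *v ?f) = Re (A $ j $ j)"
  proof -
    have "cnj u * (A $ j $ j * u) = (cnj u * u) * A $ j $ j"
      by (simp only: mult_ac)
    then show ?thesis
      by (simp only: inner_axis_matrix_axis u mult_1)
  qed
  also have "?e \<bullet> (A *v ?f) = norm z"
    using zu by (simp add: inner_axis_matrix_axis z_def)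
  also have "?e \<bullet> (A *v ?e) = Re (A $ i $ i)"
    by (simp add: inner_axis_matrix_axis)
  finally show ?thesis
    by (simp add: z_def)
qed

text \<open>For a hermitian matrix the diagonal is real and this is the trace itself.\<close>

definition re_trace :: "'n::finite cmat \<Rightarrow> real" where
  "re_trace A = (\<Sum>i\<in>UNIV. Re (A $ i $ i))"

text \<open>On positive semidefinite matrices a linear functional thus controls the norm, which
  converts summability of matrices into summability of norms.\<close>

lemma psd_norm_le_re_trace:
  fixes A :: "'n::finite cmat"
  assumes "psd A"
  shows "norm A \<le> real CARD('n) * re_trace A"
proof -
  have "norm A \<le> (\<Sum>i\<in>UNIV. \<Sum>j\<in>UNIV. norm (A $ i $ j))"
    by (rule norm_mat_le_sum)
  also have "\<dots> \<le> (\<Sum>i\<in>UNIV. \<Sum>j\<in>UNIV. (Re (A $ i $ i) + Re (A $ j $ j)) / 2)"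
    by (intro sum_mono psd_entry_le assms)
  also have "\<dots> = real CARD('n) * re_trace A"
    by (simp add: re_trace_def sum.distrib sum_distrib_left[symmetric] add_divide_distrib
        sum_divide_distrib[symmetric])
  finally show ?thesis .
qed

lemma bounded_linear_re_trace: "bounded_linear (re_trace :: 'n::finite cmat \<Rightarrow> real)"
  unfolding linear_conv_bounded_linear[symmetric] re_trace_def
  by (rule linearI) (auto simp: sum.distrib sum_distrib_left)

lemma re_trace_mono: "loewner_le A B \<Longrightarrow> re_trace A \<le> re_trace B"
  unfolding re_trace_def
proof (rule sum_mono)
  fix i
  assume "loewner_le A B"
  from loewner_le_inner[OF this, of "axis i 1"] show "Re (A $ i $ i) \<le> Re (B $ i $ i)"
    by (simp add: inner_axis_matrix_axis)
qed

lemma bounded_linear_infsum: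
  assumes "bounded_linear h" "f summable_on A"
  shows "h (infsum f A) = infsum (\<lambda>x. h (f x)) A"
  using has_sum_bounded_linear[OF assms(1) has_sum_infsum[OF assms(2)]] by (simp add: infsumI)

lemma bounded_linear_quadratic: "bounded_linear (\<lambda>A :: 'n::finite cmat. x \<bullet> (A *v x))"
  unfolding linear_conv_bounded_linear[symmetric]
  by (rule linearI) (simp_all add: mat_vec_simps)

text \<open>Being hermitian means that certain maps vanish; they are real-linear and bounded, hence
  commute with the sum.\<close>

lemma hermitian_infsum:
  fixes F :: "'a \<Rightarrow> 'n::finite cmat"
  assumes "F summable_on UNIV" "\<And>s. hermitian (F s)"
  shows "hermitian (infsum F UNIV)"
  unfolding hermitian_def
proof (intro allI)
  fix i j
  have "bounded_linear (\<lambda>A :: 'n cmat. A $ i $ j - cnj (A $ j $ i))"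
    unfolding linear_conv_bounded_linear[symmetric]
    by (rule linearI) (simp_all add: algebra_simps)
  from bounded_linear_infsum[OF this assms(1)]
  show "infsum F UNIV $ i $ j = cnj (infsum F UNIV $ j $ i)"
    using assms(2) by (simp add: hermitianD)
qed

text \<open>Summability follows by comparison with the traces of \<open>M\<close>; the bound by the
  identity follows by summing quadratic forms at a fixed vector.\<close>

lemma semi_povm_dominated:
  fixes F M :: "bool list \<Rightarrow> 'n::finite cmat"
  assumes M: "semi_povm M" and F: "\<And>s. psd (F s)" and le: "\<And>s. loewner_le (F s) (M s)"
  shows "semi_povm F"
proof -
  have sumM: "M summable_on UNIV" and leI: "loewner_le (infsum M UNIV) (mat 1)"
    using M by (auto simp: semi_povm_def)
  have "(\<lambda>s. real CARD('n) * re_trace (M s)) summable_on UNIV"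
    by (intro summable_on_cmult_right summable_on_bounded_linear[OF bounded_linear_re_trace] sumM)
  then have "(\<lambda>s. norm (F s)) summable_on UNIV"
  proof (rule Infinite_Sum.abs_summable_on_comparison_test')
    fix s
    have "norm (F s) \<le> real CARD('n) * re_trace (F s)"
      by (rule psd_norm_le_re_trace[OF F])
    also have "\<dots> \<le> real CARD('n) * re_trace (M s)"
      by (intro mult_left_mono re_trace_mono le) simp
    finally show "norm (F s) \<le> real CARD('n) * re_trace (M s)" .
  qed
  then have sumF: "F summable_on UNIV"
    by (rule abs_summable_summable)
  have "hermitian (infsum F UNIV)"
    using F by (intro hermitian_infsum sumF) (simp add: psd_iff)
  moreover have "x \<bullet> (infsum F UNIV *v x) \<le> x \<bullet> x" for x
  proof -
    note bl = bounded_linear_quadratic[of x]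
    have "x \<bullet> (infsum F UNIV *v x) = infsum (\<lambda>s. x \<bullet> (F s *v x)) UNIV"
      by (rule bounded_linear_infsum[OF bl sumF])
    also have "\<dots> \<le> infsum (\<lambda>s. x \<bullet> (M s *v x)) UNIV"
      by (intro infsum_mono summable_on_bounded_linear[OF bl] sumF sumM loewner_le_inner le)
    also have "\<dots> = x \<bullet> (infsum M UNIV *v x)"
      by (rule bounded_linear_infsum[OF bl sumM, symmetric])
    also have "\<dots> \<le> x \<bullet> x"
      using loewner_le_inner[OF leI, of x] by simp
    finally show ?thesis .
  qed
  ultimately have "loewner_le (infsum F UNIV) (mat 1)"
    by (simp add: loewner_le_def psd_iff hermitian_diff hermitian_mat mat_vec_simps)
  then show ?thesis
    using F sumF by (simp add: semi_povm_def loewner_le_def)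
qed

text \<open>More than \<open>infsum a UNIV / \<epsilon>\<close> points of the set would already
  exceed the total sum.\<close>

lemma finite_superlevel_summable_on:
  fixes a :: "'a \<Rightarrow> real"
  assumes "a summable_on UNIV" "\<And>s. 0 \<le> a s" "0 < \<epsilon>"
  shows "finite {s. \<epsilon> \<le> a s}"
proof (rule ccontr)
  assume inf: "infinite {s. \<epsilon> \<le> a s}"
  obtain n :: nat where n: "infsum a UNIV / \<epsilon> < real n"
    using reals_Archimedean2 by blast
  obtain B where B: "B \<subseteq> {s. \<epsilon> \<le> a s}" "finite B" "card B = n"
    using infinite_arbitrarily_large[OF inf] by blast
  have "real n * \<epsilon> \<le> sum a B"
    using sum_mono[of B "\<lambda>_. \<epsilon>" a] B by auto
  also have "\<dots> \<le> infsum a UNIV"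
    using B assms by (intro finite_sum_le_infsum) auto
  finally show False
    using n assms(3) by (simp add: field_simps)
qed

lemma opnorm_nonneg: "0 \<le> opnorm A"
  unfolding opnorm_def by (rule onorm_pos_le) simp

lemma opnorm_le_norm: "opnorm A \<le> norm A"
  unfolding opnorm_def by (rule onorm_bound) (auto intro: norm_matrix_vector_mult_le)

text \<open>Off a finite set of strings the trace bound \<open>a s\<close> is small for all
  \<open>n\<close> at once; on that set pointwise convergence is automatically uniform.\<close>

lemma SUP_opnorm_tendsto_0:
  fixes F :: "nat \<Rightarrow> bool list \<Rightarrow> 'n::finite cmat"
  assumes M: "semi_povm M" and F: "\<And>n s. psd (F n s)" and le: "\<And>n s. loewner_le (F n s) (M s)"
    and lim: "\<And>s. (\<lambda>n. F n s) \<longlonglongrightarrow> M s"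
  shows "(\<lambda>n. SUP s. opnorm (F n s - M s)) \<longlonglongrightarrow> 0"
proof (rule tendstoI)
  fix \<epsilon> :: real assume \<epsilon>: "0 < \<epsilon>"
  define a where "a = (\<lambda>s. real CARD('n) * re_trace (M s))"
  have "a summable_on UNIV"
    unfolding a_def using M
    by (intro summable_on_cmult_right summable_on_bounded_linear[OF bounded_linear_re_trace])
      (simp add: semi_povm_def)
  moreover have bound: "norm (F n s - M s) \<le> a s" for n s
  proof -
    have "norm (M s - F n s) \<le> real CARD('n) * re_trace (M s - F n s)"
      using le by (intro psd_norm_le_re_trace) (simp add: loewner_le_def)
    also have "\<dots> \<le> a s"
      unfolding a_def using F by (intro mult_left_mono re_trace_mono) (auto simp: loewner_le_def)
    finally show ?thesis
      by (simp add: norm_minus_commute)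
  qed
  moreover from bound have "0 \<le> a s" for s
    using norm_ge_zero order_trans by blast
  ultimately have fin: "finite {s. \<epsilon> / 2 \<le> a s}"
    using \<epsilon> by (intro finite_superlevel_summable_on) auto
  have "eventually (\<lambda>n. dist (F n s) (M s) < \<epsilon> / 2) sequentially" for s
    using \<epsilon> by (intro tendstoD[OF lim]) simp
  then have "eventually (\<lambda>n. \<forall>s\<in>{s. \<epsilon> / 2 \<le> a s}. dist (F n s) (M s) < \<epsilon> / 2) sequentially"
    using fin by (intro eventually_ball_finite) auto
  then show "eventually (\<lambda>n. dist (SUP s. opnorm (F n s - M s)) 0 < \<epsilon>) sequentially"
  proof eventually_elim
    case (elim n)
    \<comment> \<open>A supremum inherits only a non-strict bound, hence
      \<open>\<epsilon> / 2\<close>.\<close>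
    have op: "opnorm (F n s - M s) \<le> \<epsilon> / 2" for s
    proof -
      have "norm (F n s - M s) \<le> \<epsilon> / 2"
        using elim bound[of n s] by (cases "\<epsilon> / 2 \<le> a s") (auto simp: dist_norm intro: less_imp_le)
      then show ?thesis
        using opnorm_le_norm[of "F n s - M s"] by linarith
    qed
    then have "(SUP s. opnorm (F n s - M s)) \<le> \<epsilon> / 2"
      by (intro cSUP_least) auto
    moreover have "0 \<le> (SUP s. opnorm (F n s - M s))"
      by (rule cSUP_upper2[where x = "[]"]) (auto intro: bdd_aboveI2[OF op] opnorm_nonneg)
    ultimately show ?case
      using \<epsilon> by simp
  qed
qed

section \<open>Monotone approximation of a universal semi-POVM\<close>

text \<open>\<open>bl_enc\<close> is a bijection onto the natural numbers, so the weights form the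
  full geometric series and the matrices sum to the identity.\<close>

lemma semi_povm_geometric:
  "semi_povm (\<lambda>s. (1 / 2 ^ Suc (bl_enc s)) *\<^sub>R (mat 1 :: 'n::finite cmat))"
proof -
  have "((\<lambda>k. (1 / 2) ^ Suc k :: real) has_sum 1) UNIV"
    by (rule norm_summable_imp_has_sum[OF _ power_half_series])
      (use power_half_series in \<open>simp add: sums_iff\<close>)
  moreover have "range bl_enc = UNIV"
    using surj_bl_enc by (metis surjI)
  ultimately have "((\<lambda>s. (1 / 2) ^ Suc (bl_enc s) :: real) has_sum 1) UNIV"
    using has_sum_reindex[OF inj_bl_enc, of "\<lambda>k. (1 / 2) ^ Suc k :: real" 1] by (simp add: o_def)
  then have "((\<lambda>s. (1 / 2 ^ Suc (bl_enc s)) *\<^sub>R (mat 1 :: 'n cmat)) has_sum 1 *\<^sub>R mat 1) UNIV"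
    unfolding power_one_over by (rule has_sum_bounded_linear[OF bounded_linear_scaleR_left])
  moreover have "psd ((1 / 2 ^ Suc (bl_enc s)) *\<^sub>R (mat 1 :: 'n cmat))" for s
    by (intro posdef_imp_psd posdef_scaleR posdef_mat) simp
  moreover have "psd (0 :: 'n cmat)"
    by (simp add: psd_iff hermitian_0)
  ultimately show ?thesis
    unfolding semi_povm_def loewner_le_def by (auto simp: infsumI summable_on_def simp del: power_Suc)
qed

lemma rat_scaleR_mat_in_HerQ: "r \<in> \<rat> \<Longrightarrow> r *\<^sub>R mat 1 \<in> HerQ"
  unfolding HerQ_def by (auto simp: hermitian_scaleR hermitian_mat) (auto simp: mat_def)

lemma HerQ_diff: "A \<in> HerQ \<Longrightarrow> B \<in> HerQ \<Longrightarrow> A - B \<in> HerQ"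
  unfolding HerQ_def by (auto simp: hermitian_diff)

text \<open>The values are rational already, so a constant sequence serves as the
  approximation.\<close>

lemma lower_computable_geometric:
  "lower_computable (\<lambda>s. (1 / 2 ^ Suc (bl_enc s)) *\<^sub>R (mat 1 :: 'n::enum cmat))"
  unfolding lower_computable_def
proof (intro conjI exI allI)
  let ?R = "\<lambda>s. (1 / 2 ^ Suc (bl_enc s)) *\<^sub>R (mat 1 :: 'n cmat)"
  show "semi_povm ?R"
    by (rule semi_povm_geometric)
  \<comment> \<open>The power of 2 is written as a successor to fit
    \<open>rat_recursive_inverse_Suc\<close>.\<close>
  define A where "A = (\<lambda>z. (1 / real (Suc (2 ^ Suc (psnd z) - 1))) *\<^sub>R (mat 1 :: 'n cmat))"
  have "mat_recursive A"
    unfolding A_def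
    by (intro mat_recursive_scaleR mat_recursive_mat rat_recursive_inverse_Suc recursive_diff
        recursive_const recursive_comp[OF recursive_power2] recursive_Suc_comp recursive_psnd)
  moreover have "A (prod_encode (n, bl_enc s)) = ?R s" for n s
    by (simp add: A_def of_nat_diff)
  ultimately show "total_recursive_mat (\<lambda>_. ?R)"
    unfolding total_recursive_mat_iff by blast
  show "?R s \<in> HerQ" for s
    by (intro rat_scaleR_mat_in_HerQ) simp
  show "loewner_le (?R s) (?R s)" for s
    by (simp add: loewner_le_def psd_iff hermitian_0)
qed simp

text \<open>This is the one place where universality enters beyond lower computability.\<close>

lemma universal_semi_povm_posdef:
  fixes M :: "bool list \<Rightarrow> 'n::enum cmat"
  assumes "universal_semi_povm M"
  shows "posdef (M s)"
proof -
  let ?R = "\<lambda>s. (1 / 2 ^ Suc (bl_enc s)) *\<^sub>R (mat 1 :: 'n cmat)"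
  obtain c where c: "0 < c" "\<And>s. loewner_le (c *\<^sub>R ?R s) (M s)"
    using assms lower_computable_geometric unfolding universal_semi_povm_def by blast
  have "posdef (c *\<^sub>R ?R s + (M s - c *\<^sub>R ?R s))"
    using c by (intro posdef_add_psd posdef_scaleR posdef_mat) (auto simp: loewner_le_def)
  then show ?thesis by simp
qed

lemma decidable_pd_cert:
  fixes D :: "nat \<Rightarrow> 'n::enum cmat"
  assumes "mat_recursive D" "recursive t" "recursive j"
  shows "decidable (\<lambda>z. pd_cert (D z) (t z) (j z))"
  unfolding pd_cert_def
proof (intro decidable_norm_less_1 mat_recursive_funpow mat_recursive_diff mat_recursive_mat
    mat_recursive_scaleR rat_recursive_inverse_Suc assms)
  show "mat_recursive (\<lambda>y. msquare (mat_dec y) :: 'n cmat)"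
    unfolding msquare_def by (intro mat_recursive_matrix_mult mat_recursive_mat_dec)
qed

text \<open>Positive definiteness holds for all late indices, so the search may start at
  \<open>n\<close>; this later forces the selected indices to infinity.\<close>

lemma ex_pd_cert_in_tail:
  fixes X :: "nat \<Rightarrow> 'n::finite cmat"
  assumes "X \<longlonglongrightarrow> M" "\<And>k. hermitian (X k)" "hermitian Y" "posdef (M - Y)"
  shows "\<exists>k t j. pd_cert (X (n + k) - Y) t j"
proof -
  have "(\<lambda>k. X k - Y) \<longlonglongrightarrow> M - Y"
    by (intro tendsto_intros assms)
  then have "eventually (\<lambda>k. posdef (X k - Y)) sequentially"
    by (rule posdef_eventually) (intro assms hermitian_diff)+
  then obtain m where "\<And>k. m \<le> k \<Longrightarrow> posdef (X k - Y)"
    unfolding eventually_sequentially by blast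
  then have "posdef (X (n + m) - Y)"
    by simp
  then show ?thesis
    using pd_cert_if_posdef by blast
qed

theorem mainTheorem10:
  fixes M :: "bool list \<Rightarrow> ('n::{finite,enum}) cmat"
  assumes "universal_semi_povm M"
  shows "\<exists>F :: nat \<Rightarrow> bool list \<Rightarrow> ('n::{finite,enum}) cmat.
           (\<forall>n. semi_povm (F n)) \<and>
           (\<forall>n s. F n s \<in> HerQ \<and> posdef (F n s) \<and>
                  loewner_le (F n s) (F (Suc n) s) \<and> loewner_le (F (Suc n) s) (M s)) \<and>
           (\<lambda>n. SUP s. opnorm (F n s - M s)) \<longlonglongrightarrow> 0 \<and>
           total_recursive_mat F"
proof -
  obtain f where M: "semi_povm M" and f: "total_recursive_mat f" "\<And>n s. f n s \<in> HerQ"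
      "\<And>s. (\<lambda>n. f n s) \<longlonglongrightarrow> M s" "\<And>n s. loewner_le (f n s) (M s)"
    using assms unfolding universal_semi_povm_def lower_computable_def by blast
  define X where "X = (\<lambda>k s. f k s - (1 / real (Suc k)) *\<^sub>R (mat 1 :: 'n cmat))"
  have X_HerQ: "X k s \<in> HerQ" for k s
    unfolding X_def by (intro HerQ_diff f rat_scaleR_mat_in_HerQ) simp
  then have X_herm: "hermitian (X k s)" for k s
    by (simp add: HerQ_def)
  have X_less: "posdef (M s - X k s)" for k s
  proof -
    have "posdef ((1 / real (Suc k)) *\<^sub>R mat 1 + (M s - f k s))"
      using f(4) by (intro posdef_add_psd posdef_scaleR posdef_mat) (auto simp: loewner_le_def)
    then show ?thesis
      by (simp add: X_def algebra_simps)
  qed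
  have X_lim: "(\<lambda>k. X k s) \<longlonglongrightarrow> M s" for s
  proof -
    have "(\<lambda>k. 1 / real (Suc k)) \<longlonglongrightarrow> 0"
      using LIMSEQ_inverse_real_of_nat by (simp add: inverse_eq_divide)
    then have "(\<lambda>k. f k s - (1 / real (Suc k)) *\<^sub>R (mat 1 :: 'n cmat)) \<longlonglongrightarrow> M s - 0 *\<^sub>R mat 1"
      by (intro tendsto_intros f)
    then show ?thesis
      by (simp add: X_def)
  qed

  obtain A where A: "mat_recursive A" "\<And>n s. A (prod_encode (n, bl_enc s)) = f n s"
    using f(1) unfolding total_recursive_mat_iff by blast
  have "mat_recursive (\<lambda>z. A z - (1 / real (Suc (pfst z))) *\<^sub>R mat 1)"
    by (intro mat_recursive_diff A mat_recursive_scaleR mat_recursive_mat rat_recursive_inverse_Suc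
        recursive_pfst)
  then obtain c where c: "recursive c" "\<And>z. mat_dec (c z) = A z - (1 / real (Suc (pfst z))) *\<^sub>R mat 1"
    using mat_recursive_code by blast
  have c_X: "mat_dec (c (prod_encode (k, bl_enc s))) = X k s" for k s
    by (simp add: c A X_def)

  \<comment> \<open>The number \<open>w\<close> packs an offset \<open>k\<close> and a certificate
    \<open>t\<close>, \<open>j\<close>, so that one minimisation finds all three. Here
    \<open>y\<close> is the code of the current matrix and \<open>e\<close> that of the
    string.\<close>
  define h where "h = (\<lambda>w n (y::nat) e. c (prod_encode (n + pfst w, e)))"
  define P where "P = (\<lambda>w n y e. pd_cert (mat_dec (h w n y e) - mat_dec y :: 'n cmat)
      (pfst (psnd w)) (psnd (psnd w)))"
  define W where "W = (\<lambda>n y e. LEAST w. P w n y e)"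
  define Y where "Y = (\<lambda>n e. rec_nat 0 (\<lambda>n y. h (W n y e) n y e) n)"
  define Z where "Z = (\<lambda>n s. mat_dec (Y n (bl_enc s)) :: 'n cmat)"
  define K where "K = (\<lambda>n s. n + pfst (W n (Y n (bl_enc s)) (bl_enc s)))"
  have Z_Suc: "Z (Suc n) s = X (K n s) s" for n s
    by (simp add: Z_def Y_def h_def c_X K_def)
  have Z_0: "Z 0 s = 0" for s
  proof -
    \<comment> \<open>The recursion starts at the number 0, which has to decode to the zero matrix:
      the list is empty, and the default entry 0 decodes to \<open>0 / 0 = 0\<close> in both
      parts.\<close>
    have "prod_decode 0 = (0, 0)"
      by (simp add: prod_decode_def prod_decode_aux.simps)
    then have "gq_dec 0 = 0"
      by (simp add: gq_dec_def rat_dec_def complex_eq_iff)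
    then show ?thesis
      by (simp add: Z_def Y_def mat_dec_def vec_eq_iff)
  qed
  \<comment> \<open>A case split suffices: \<open>Z 0 s\<close> is zero and every later
    \<open>Z n s\<close> is some \<open>X k s\<close>. This keeps the search alive at every
    stage.\<close>
  have inv: "hermitian (Z n s) \<and> posdef (M s - Z n s)" for n s
    using universal_semi_povm_posdef[OF assms] X_herm X_less
    by (cases n) (auto simp: Z_0 Z_Suc hermitian_0)
  have ex: "\<exists>w. P w n (Y n e) e" for n e
  proof -
    obtain s where s: "e = bl_enc s"
      using surj_bl_enc by metis
    obtain k t j where "pd_cert (X (n + k) s - Z n s) t j"
      using ex_pd_cert_in_tail[OF X_lim X_herm] inv by blast
    then have "P (prod_encode (k, prod_encode (t, j))) n (Y n e) e"
      by (simp add: P_def h_def s c_X Z_def)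
    then show ?thesis ..
  qed
  have Z_step: "posdef (Z (Suc n) s - Z n s)" for n s
  proof (rule posdef_if_pd_cert)
    show "hermitian (Z (Suc n) s - Z n s)"
      using inv by (intro hermitian_diff) auto
    let ?w = "W n (Y n (bl_enc s)) (bl_enc s)"
    have "P ?w n (Y n (bl_enc s)) (bl_enc s)"
      unfolding W_def by (rule LeastI_ex[OF ex])
    then show "pd_cert (Z (Suc n) s - Z n s) (pfst (psnd ?w)) (psnd (psnd ?w))"
      by (simp add: P_def Z_def Y_def)
  qed
  have Z_psd: "psd (Z n s)" for n s
  proof (induction n)
    case (Suc n)
    from psd_add[OF this posdef_imp_psd[OF Z_step[of n s]]] show ?case by simp
  qed (simp add: Z_0 psd_iff hermitian_0)
  have Z_le: "loewner_le (Z n s) (M s)" for n s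
    using inv by (simp add: loewner_le_def posdef_imp_psd)

  \<comment> \<open>The shift drops the zero matrix \<open>Z 0 s\<close>; each later term is a
    positive semidefinite matrix plus a positive definite increment.\<close>
  define F where "F = (\<lambda>n. Z (Suc n))"
  have "semi_povm (F n)" for n
    unfolding F_def by (intro semi_povm_dominated[OF M] Z_psd Z_le)
  moreover have "F n s \<in> HerQ \<and> posdef (F n s) \<and>
      loewner_le (F n s) (F (Suc n) s) \<and> loewner_le (F (Suc n) s) (M s)" for n s
  proof (intro conjI)
    show "F n s \<in> HerQ"
      by (simp add: F_def Z_Suc X_HerQ)
    show "posdef (F n s)"
      using posdef_add_psd[OF Z_step Z_psd, of n s n s] by (simp add: F_def)
    show "loewner_le (F n s) (F (Suc n) s)"
      using Z_step by (simp add: F_def loewner_le_def posdef_imp_psd)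
    show "loewner_le (F (Suc n) s) (M s)"
      by (simp add: F_def Z_le)
  qed
  moreover have "(\<lambda>n. SUP s. opnorm (F n s - M s)) \<longlonglongrightarrow> 0"
  proof (rule SUP_opnorm_tendsto_0[OF M])
    show "psd (F n s)" "loewner_le (F n s) (M s)" for n s
      by (simp_all add: F_def Z_psd Z_le)
    show "(\<lambda>n. F n s) \<longlonglongrightarrow> M s" for s
    proof -
      \<comment> \<open>The indices need not increase, but \<open>n \<le> K n s\<close>.\<close>
      have "filterlim (\<lambda>n. K n s) at_top sequentially"
        by (rule filterlim_at_top_mono[OF filterlim_ident]) (simp add: K_def)
      then show ?thesis
        unfolding F_def Z_Suc by (rule filterlim_compose[OF X_lim])
    qed
  qed
  moreover have "total_recursive_mat F"
    unfolding total_recursive_mat_iff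
  proof (intro exI conjI allI)
    have "recursive (\<lambda>z. Y (pfst z) (psnd z))"
    proof (rule recursive_search_sequence)
      show rec_h: "recursive (\<lambda>z. h (pfst z) (pfst (psnd z)) (pfst (psnd (psnd z))) (psnd (psnd (psnd z))))"
        unfolding h_def
        by (intro recursive_comp[OF c(1)] recursive_prod_encode recursive_add recursive_pfst_comp
            recursive_psnd_comp recursive_id)
      show "decidable (\<lambda>z. P (pfst z) (pfst (psnd z)) (pfst (psnd (psnd z))) (psnd (psnd (psnd z))))"
        unfolding P_def
        by (intro decidable_pd_cert mat_recursive_diff mat_recursive_comp[OF mat_recursive_mat_dec]
            rec_h recursive_pfst_comp recursive_psnd_comp recursive_id)
      show "\<exists>w. P w n (Y n e) e" for n e
        by (rule ex)
    qed (simp_all add: Y_def W_def)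
    \<comment> \<open>Precomposition with a recursive map on pairs realises the index shift in
      \<open>F\<close>.\<close>
    then have "recursive (\<lambda>z. Y (pfst (prod_encode (Suc (pfst z), psnd z)))
        (psnd (prod_encode (Suc (pfst z), psnd z))))"
      by (rule recursive_comp)
        (intro recursive_prod_encode recursive_Suc_comp recursive_pfst recursive_psnd)
    then show "mat_recursive (\<lambda>z. mat_dec (Y (Suc (pfst z)) (psnd z)) :: 'n cmat)"
      by (intro mat_recursive_comp[OF mat_recursive_mat_dec]) simp
    show "mat_dec (Y (Suc (pfst (prod_encode (n, bl_enc s)))) (psnd (prod_encode (n, bl_enc s)))) = F n s"
      for n s
      by (simp add: F_def Z_def)
  qed
  ultimately show ?thesis
    by blast
qed

end
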